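(* Let $G=(V,E)$ be a finite connected outerplanar graph with no universal vertex, and with a fixed outerplanar embedding $\Pi$. Then $\mathrm{cc}(G)=2$ if and only if $\Pi$ has at most one internal $k$-face with $k\in\{5,6\}$ and no internal $t$-face with $t>6$.
   Context: All graphs are finite, connected and reflexive (a loop at every vertex; moving along a loop means passing); loops are ignored in embeddings and faces. An internal face of an outerplanar embedding is a bounded face (all vertices lie on the unbounded face); a $k$-face is a face whose boundary has length $k$. A universal vertex is one adjacent to all other vertices. Cops and Attacking Robbers: the cop player places $k$ cops on vertices, then the robber chooses a vertex. In each round the cops move (each cop moves to an adjacent vertex or passes), then the robber moves (to an adjacent vertex or passes). The cops win if after finitely many moves a cop moves onto the robber's vertex. Additionally, if the robber moves onto a vertex occupied by a cop, exactly one cop on that vertex is removed from the game; the robber's initial placement on a cop's vertex does not count as an attack. Both players play optimally. The attacking cop number $\mathrm{cc}(G)$ is the least $k$ such that $k$ cops can guarantee a win. *)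

theory Defs
  imports Main "HOL-Library.Multiset"
begin

text \<open>A graph is a finite vertex set V with a symmetric, irreflexive adjacency E
  (loops are implicit: the game uses closed neighbourhoods, and loops are ignored
  in embeddings and faces).\<close>

definition graph :: "'a set \<Rightarrow> ('a \<Rightarrow> 'a \<Rightarrow> bool) \<Rightarrow> bool" where
  "graph V E \<longleftrightarrow> finite V \<and> (\<forall>u v. E u v \<longrightarrow> u \<in> V \<and> v \<in> V)
     \<and> (\<forall>u v. E u v \<longrightarrow> E v u) \<and> (\<forall>v. \<not> E v v)"

definition connected_graph :: "'a set \<Rightarrow> ('a \<Rightarrow> 'a \<Rightarrow> bool) \<Rightarrow> bool" where
  "connected_graph V E \<longleftrightarrow> V \<noteq> {} \<and> (\<forall>u\<in>V. \<forall>v\<in>V. E\<^sup>*\<^sup>* u v)"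

definition universal_vertex :: "'a set \<Rightarrow> ('a \<Rightarrow> 'a \<Rightarrow> bool) \<Rightarrow> 'a \<Rightarrow> bool" where
  "universal_vertex V E v \<longleftrightarrow> v \<in> V \<and> (\<forall>u\<in>V. u \<noteq> v \<longrightarrow> E v u)"

definition nbrs :: "('a \<Rightarrow> 'a \<Rightarrow> bool) \<Rightarrow> 'a \<Rightarrow> 'a set" where
  "nbrs E v = {u. E v u}"

definition darts :: "'a set \<Rightarrow> ('a \<Rightarrow> 'a \<Rightarrow> bool) \<Rightarrow> ('a \<times> 'a) set" where
  "darts V E = {(u, v). u \<in> V \<and> v \<in> V \<and> E u v}"

text \<open>A rotation system: at every vertex v, sigma v is a cyclic permutation of
  the neighbours of v (the clockwise order of the edges around v).\<close>

definition rotation_system ::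
  "'a set \<Rightarrow> ('a \<Rightarrow> 'a \<Rightarrow> bool) \<Rightarrow> ('a \<Rightarrow> 'a \<Rightarrow> 'a) \<Rightarrow> bool" where
  "rotation_system V E \<sigma> \<longleftrightarrow>
     (\<forall>v\<in>V. bij_betw (\<sigma> v) (nbrs E v) (nbrs E v)
        \<and> (\<forall>u\<in>nbrs E v. \<forall>w\<in>nbrs E v. \<exists>n. (\<sigma> v ^^ n) u = w))"

definition face_step :: "('a \<Rightarrow> 'a \<Rightarrow> 'a) \<Rightarrow> 'a \<times> 'a \<Rightarrow> 'a \<times> 'a" where
  "face_step \<sigma> d = (snd d, \<sigma> (snd d) (fst d))"

definition face_of :: "('a \<Rightarrow> 'a \<Rightarrow> 'a) \<Rightarrow> 'a \<times> 'a \<Rightarrow> ('a \<times> 'a) set" where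
  "face_of \<sigma> d = {(face_step \<sigma> ^^ n) d | n. True}"

text \<open>Faces are the orbits of the face-tracing permutation on darts; the length
  of (the boundary walk of) a face is the number of darts in its orbit.\<close>

definition faces ::
  "'a set \<Rightarrow> ('a \<Rightarrow> 'a \<Rightarrow> bool) \<Rightarrow> ('a \<Rightarrow> 'a \<Rightarrow> 'a) \<Rightarrow> ('a \<times> 'a) set set" where
  "faces V E \<sigma> = face_of \<sigma> ` darts V E"

text \<open>Plane embedding: Euler's formula |V| - |E| + |F| = 2 (genus 0).\<close>

definition plane_embedding ::
  "'a set \<Rightarrow> ('a \<Rightarrow> 'a \<Rightarrow> bool) \<Rightarrow> ('a \<Rightarrow> 'a \<Rightarrow> 'a) \<Rightarrow> bool" where
  "plane_embedding V E \<sigma> \<longleftrightarrow> rotation_system V E \<sigma> \<and>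
     card V + card (faces V E \<sigma>) = card (darts V E) div 2 + 2"

text \<open>An outerplanar embedding: a plane embedding together with a designated
  unbounded (outer) face Of on whose boundary every vertex lies.\<close>

definition outerplanar_embedding ::
  "'a set \<Rightarrow> ('a \<Rightarrow> 'a \<Rightarrow> bool) \<Rightarrow> ('a \<Rightarrow> 'a \<Rightarrow> 'a) \<Rightarrow> ('a \<times> 'a) set \<Rightarrow> bool" where
  "outerplanar_embedding V E \<sigma> Of \<longleftrightarrow> plane_embedding V E \<sigma> \<and>
     Of \<in> faces V E \<sigma> \<and> (\<forall>v\<in>V. \<exists>w. (v, w) \<in> Of)"

definition internal_faces ::
  "'a set \<Rightarrow> ('a \<Rightarrow> 'a \<Rightarrow> bool) \<Rightarrow> ('a \<Rightarrow> 'a \<Rightarrow> 'a) \<Rightarrow> ('a \<times> 'a) set \<Rightarrow> ('a \<times> 'a) set set" where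
  "internal_faces V E \<sigma> Of = faces V E \<sigma> - {Of}"

definition cmove :: "('a \<Rightarrow> 'a \<Rightarrow> bool) \<Rightarrow> 'a \<Rightarrow> 'a \<Rightarrow> bool" where
  "cmove E x y \<longleftrightarrow> x = y \<or> E x y"

text \<open>cop_win E C r: it is the cops' turn, the (remaining) cops stand on the
  multiset of vertices C, the robber is on r, and the cops can force a capture
  in finitely many moves (least fixed point = reachability). After the cops'
  move C', if a cop is on r the cops win; otherwise the robber moves to r', and
  if r' carries a cop exactly one cop there is removed.\<close>

inductive cop_win :: "('a \<Rightarrow> 'a \<Rightarrow> bool) \<Rightarrow> 'a multiset \<Rightarrow> 'a \<Rightarrow> bool"
  for E where
  capture: "rel_mset (cmove E) C C' \<Longrightarrow> r \<in># C' \<Longrightarrow> cop_win E C r"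
| step: "rel_mset (cmove E) C C' \<Longrightarrow> r \<notin># C' \<Longrightarrow>
    (\<forall>r'. cmove E r r' \<longrightarrow>
        cop_win E (if r' \<in># C' then C' - {#r'#} else C') r') \<Longrightarrow> cop_win E C r"

definition cops_win :: "'a set \<Rightarrow> ('a \<Rightarrow> 'a \<Rightarrow> bool) \<Rightarrow> nat \<Rightarrow> bool" where
  "cops_win V E k \<longleftrightarrow>
     (\<exists>C. size C = k \<and> set_mset C \<subseteq> V \<and> (\<forall>r\<in>V. cop_win E C r))"

definition attacking_cop_number :: "'a set \<Rightarrow> ('a \<Rightarrow> 'a \<Rightarrow> bool) \<Rightarrow> nat" where
  "attacking_cop_number V E = (LEAST k. cops_win V E k)"

end

theory Submission
  imports Defs
begin

text \<open>
  Counting mod 2, Euler's formula says that every edge set with all degrees even is the boundary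
  of a unique set of internal faces: a discrete Jordan curve theorem. As every vertex lies on the
  outer face, an even edge set encloses no face at a vertex it does not touch. Hence the inside of an
  induced cycle is a single face, every internal face arises in this way, and a component of the graph
  minus an induced cycle attaches to at most two vertices of the cycle, which are adjacent.

  Robber: on an induced cycle of length at least 5, a robber who is not captured immediately can always
  pass, attack safely, or step to a safe neighbour on the cycle. So two cops win only if
  they dominate all such cycles at the start; they cannot dominate a cycle of length at least 7, nor two
  different cycles of length at least 5.

  Cops: they stay on equal or adjacent vertices \<open>u\<close>, \<open>v\<close>, so that they protect each other, and shrink
  the component of the robber in the graph minus \<open>u\<close>, \<open>v\<close>. If it attaches to both, a shortest cycle through
  the edge \<open>uv\<close> and the component has length at most 4, and the cops can move to the edge of that cycle
  behind which the robber sits. If there is a cycle of length 5 or 6, they start by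
  dominating it and then close in on the edge at which the component of the robber attaches.
\<close>

section \<open>Boundaries modulo 2 and the discrete Jordan curve theorem\<close>

text \<open>The embedding is only a rotation system satisfying Euler's formula, so no topological
  inside is available; parity has to supply one. That every vertex lies on the outer face enters
  only through \<open>ins_untouched\<close>, and each separation statement for an induced cycle
  comes down to exhibiting closed curves that miss a vertex of it.

  The constants come from domination. A vertex dominates at most three vertices of an induced cycle,
  so two cops dominate at most six. From length 5 on, the two neighbours of the robber on the cycle
  have no second common neighbour there, which leaves a safe reply. Up to length 4, cops on one edge
  of the cycle reach any other edge of it in one move, so they can pass across it without losing
  each other's protection. One longer cycle is tolerable because it has to be dominated only at the
  start. The absence of a universal vertex rules out a win by a single cop.\<close>

lemma even_card_sym_diff:
  assumes "finite A" "finite B"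
  shows "even (card (sym_diff A B)) \<longleftrightarrow> (even (card A) \<longleftrightarrow> even (card B))"
proof -
  have "card A = card (A - B) + card (A \<inter> B)" "card B = card (B - A) + card (A \<inter> B)"
    using assms by (metis Int_Diff_Un Int_Diff_disjoint add.commute card_Un_disjoint finite_Diff finite_Int,
        metis Int_Diff_Un Int_Diff_disjoint Int_commute add.commute card_Un_disjoint finite_Diff finite_Int)
  moreover have "card (sym_diff A B) = card (A - B) + card (B - A)"
    using assms by (intro card_Un_disjoint) auto
  ultimately show ?thesis by simp presburger
qed

text \<open>Around each cycle of \<open>p\<close> the truth value changes an even number of times.
  With the rotation at a vertex as \<open>p\<close>, this is the local reason why boundaries have
  even degrees.\<close>

lemma even_card_changes_bij:
  fixes g :: "'a \<Rightarrow> bool"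
  assumes fin: "finite N" and bij: "bij_betw p N N"
  shows "even (card {w\<in>N. g w \<noteq> g (p w)})"
proof -
  let ?A = "{w\<in>N. g w}" and ?B = "{w\<in>N. g (p w)}"
  have "p ` ?B = ?A"
    using bij unfolding bij_betw_def by auto
  moreover have "inj_on p ?B"
    using bij unfolding bij_betw_def inj_on_def by auto
  ultimately have "card ?A = card ?B"
    using card_image by fastforce
  moreover have "{w\<in>N. g w \<noteq> g (p w)} = sym_diff ?A ?B" by auto
  ultimately show ?thesis
    using even_card_sym_diff[of ?A ?B] fin by simp
qed

lemma funpow_closed:
  assumes "\<And>x. x \<in> A \<Longrightarrow> f x \<in> A" "x \<in> A"
  shows "(f ^^ n) x \<in> A"
  using assms by (induction n) auto

lemma funpow_period:
  assumes fin: "finite A" and cl: "\<And>x. x \<in> A \<Longrightarrow> f x \<in> A" and inj: "inj_on f A" and x: "x \<in> A"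
  shows "\<exists>n>0. (f ^^ n) x = x"
proof -
  have "\<not> inj (\<lambda>n. (f ^^ n) x)"
    using fin funpow_closed[of A f, OF cl x] by (metis finite_subset image_subsetI infinite_UNIV_nat finite_imageD)
  then obtain i j where ij: "i < j" "(f ^^ i) x = (f ^^ j) x"
    unfolding inj_def by (metis linorder_neqE_nat)
  have "(f ^^ i) x = (f ^^ (i + k)) x \<Longrightarrow> x = (f ^^ k) x" for k
  proof (induction i)
    case (Suc i)
    then have "f ((f ^^ i) x) = f ((f ^^ (i + k)) x)" by simp
    then have "(f ^^ i) x = (f ^^ (i + k)) x"
      using inj funpow_closed[of A f, OF cl x] by (meson inj_onD)
    then show ?case using Suc.IH by simp
  qed simp
  from this[of "j - i"] ij show ?thesis
    by (intro exI[of _ "j - i"]) auto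
qed

locale outerplane =
  fixes V :: "'a set" and E :: "'a \<Rightarrow> 'a \<Rightarrow> bool"
    and \<sigma> :: "'a \<Rightarrow> 'a \<Rightarrow> 'a" and Of :: "('a \<times> 'a) set"
  assumes graph: "graph V E" and conn: "connected_graph V E"
    and emb: "outerplanar_embedding V E \<sigma> Of"
begin

abbreviation D :: "('a \<times> 'a) set" where "D \<equiv> darts V E"
abbreviation fs :: "'a \<times> 'a \<Rightarrow> 'a \<times> 'a" where "fs \<equiv> face_step \<sigma>"
abbreviation F :: "'a \<times> 'a \<Rightarrow> ('a \<times> 'a) set" where "F \<equiv> face_of \<sigma>"

definition Es :: "'a set set" where "Es = {{u, v} |u v. E u v}"

text \<open>Homology mod 2: \<open>oddv\<close> is the boundary map from edge sets to vertex sets,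
  \<open>even_edges\<close> the cycle space, and \<open>bd\<close> the boundary map from face sets
  to edge sets.\<close>

definition oddv :: "'a set set \<Rightarrow> 'a set" where
  "oddv Z = {v\<in>V. odd (card {w. {v, w} \<in> Z})}"

definition even_edges :: "'a set set \<Rightarrow> bool" where
  "even_edges Z \<longleftrightarrow> Z \<subseteq> Es \<and> oddv Z = {}"

definition bd :: "('a \<times> 'a) set set \<Rightarrow> 'a set set" where
  "bd S = {{u, v} |u v. E u v \<and> (F (u, v) \<in> S) \<noteq> (F (v, u) \<in> S)}"

text \<open>Complementary face sets have the same boundary; leaving out \<open>Of\<close> selects
  the bounded side and makes \<open>S\<close> unique.\<close>

definition ins :: "'a set set \<Rightarrow> 'a \<times> 'a \<Rightarrow> bool" where
  "ins Z d \<longleftrightarrow> (\<exists>S. S \<subseteq> faces V E \<sigma> - {Of} \<and> bd S = Z \<and> F d \<in> S)"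

section \<open>Darts, edges and face orbits\<close>

lemma finV: "finite V" and E_sym: "E u v \<Longrightarrow> E v u" and E_irr: "\<not> E v v"
  and E_V: "E u v \<Longrightarrow> u \<in> V" "E u v \<Longrightarrow> v \<in> V"
  using graph unfolding graph_def by blast+

lemma V_ne: "V \<noteq> {}" and reach: "u \<in> V \<Longrightarrow> v \<in> V \<Longrightarrow> E\<^sup>*\<^sup>* u v"
  using conn unfolding connected_graph_def by blast+

lemma rot: "rotation_system V E \<sigma>"
  and euler: "card V + card (faces V E \<sigma>) = card D div 2 + 2"
  and Of_face: "Of \<in> faces V E \<sigma>" and on_Of: "v \<in> V \<Longrightarrow> \<exists>w. (v, w) \<in> Of"
  using emb unfolding outerplanar_embedding_def plane_embedding_def by blast+

lemma D_iff [simp]: "(u, v) \<in> D \<longleftrightarrow> E u v"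
  using E_V unfolding darts_def by auto

lemma finD: "finite D"
  using finite_subset[of D "V \<times> V"] finV unfolding darts_def by auto

lemma fin_nbrs: "finite {w. E v w}"
  by (rule finite_subset[OF _ finV]) (auto dest: E_V)

lemma fs_D: "d \<in> D \<Longrightarrow> fs d \<in> D"
proof -
  assume d: "d \<in> D"
  obtain u v where uv: "d = (u, v)" by (cases d)
  have "bij_betw (\<sigma> v) (nbrs E v) (nbrs E v)"
    using rot E_V d uv unfolding rotation_system_def by auto
  then have "\<sigma> v u \<in> nbrs E v"
    using d uv E_sym unfolding bij_betw_def nbrs_def by auto
  then show ?thesis using uv unfolding nbrs_def face_step_def by simp
qed

lemma fs_inj: "inj_on fs D"
proof (rule inj_onI)
  fix d d' assume d: "d \<in> D" "d' \<in> D" and eq: "fs d = fs d'"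
  obtain u v where uv: "d = (u, v)" by (cases d)
  obtain u' v' where uv': "d' = (u', v')" by (cases d')
  have v: "v = v'" "\<sigma> v u = \<sigma> v u'" using eq uv uv' unfolding face_step_def by auto
  have "inj_on (\<sigma> v) (nbrs E v)"
    using rot E_V d uv unfolding rotation_system_def bij_betw_def by auto
  then show "d = d'" using d uv uv' v E_sym unfolding nbrs_def inj_on_def by auto
qed

lemma F_refl: "d \<in> F d"
  unfolding face_of_def by (auto intro: exI[of _ 0])

lemma F_sub: "d \<in> D \<Longrightarrow> F d \<subseteq> D"
  using funpow_closed[of D fs, OF fs_D] unfolding face_of_def by blast

lemma period: "d \<in> D \<Longrightarrow> \<exists>n>0. (fs ^^ n) d = d"
  using funpow_period[of D fs] finD fs_D fs_inj by blast

lemma F_eq: 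
  assumes d: "d \<in> D" and d': "d' \<in> F d" shows "F d' = F d"
proof -
  obtain m where m: "d' = (fs ^^ m) d" using d' unfolding face_of_def by auto
  obtain n where n: "n > 0" "(fs ^^ n) d = d" using period[OF d] by blast
  have mult: "(fs ^^ (n * k)) d = d" for k
    using n by (induction k) (auto simp: funpow_add)
  \<comment> \<open>\<open>n\<close> is a period of \<open>d\<close>, so \<open>n * m - m\<close>
    further steps complete full rounds and lead from \<open>d'\<close> back to
    \<open>d\<close>.\<close>
  have "(fs ^^ k) d = (fs ^^ (k + (n * m - m))) d'" for k
  proof -
    have "(fs ^^ (k + (n * m - m))) d' = (fs ^^ (k + (n * m - m) + m)) d"
      using m by (simp add: funpow_add)
    also have "k + (n * m - m) + m = k + n * m" using n by (cases n) auto
    also have "(fs ^^ (k + n * m)) d = (fs ^^ k) d" using mult by (simp add: funpow_add)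
    finally show ?thesis by simp
  qed
  moreover have "(fs ^^ k) d' = (fs ^^ (k + m)) d" for k using m by (simp add: funpow_add)
  ultimately show ?thesis unfolding face_of_def by blast
qed

lemma F_step: "d \<in> D \<Longrightarrow> F (fs d) = F d"
  using F_eq[of d "fs d"] unfolding face_of_def by (metis (mono_tags, lifting) funpow_0 funpow_simps_right(2) mem_Collect_eq o_apply)

lemma fs_surj: "d \<in> D \<Longrightarrow> \<exists>d'\<in>D. fs d' = d"
proof -
  assume d: "d \<in> D"
  obtain n where n: "n > 0" "(fs ^^ n) d = d" using period[OF d] by blast
  then have "fs ((fs ^^ (n - 1)) d) = d"
    by (metis Suc_pred' funpow.simps(2) o_apply)
  then show ?thesis using funpow_closed[of D fs, OF fs_D d] by blast
qed

lemma F_rot: "E u v \<Longrightarrow> F (v, \<sigma> v u) = F (u, v)"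
  using F_step[of "(u, v)"] unfolding face_step_def by simp

lemma Es_iff [simp]: "{u, v} \<in> Es \<longleftrightarrow> E u v"
  using E_sym unfolding Es_def by (auto simp: doubleton_eq_iff)

lemma bd_iff: "{u, v} \<in> bd S \<longleftrightarrow> E u v \<and> (F (u, v) \<in> S) \<noteq> (F (v, u) \<in> S)"
  using E_sym unfolding bd_def by (auto simp: doubleton_eq_iff)

lemma Es_cases: "e \<in> Es \<Longrightarrow> (\<And>u v. E u v \<Longrightarrow> e = {u, v} \<Longrightarrow> thesis) \<Longrightarrow> thesis"
  unfolding Es_def by blast

lemma bd_sub: "bd S \<subseteq> Es"
  unfolding bd_def Es_def by blast

lemma finEs: "finite Es"
  by (rule finite_subset[of _ "Pow V"]) (use finV E_V in \<open>auto simp: Es_def\<close>)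

lemma card_darts: "card D = 2 * card Es"
proof -
  let ?h = "\<lambda>d. {fst d, snd d}"
  have img: "?h ` D = Es" unfolding Es_def image_def by (auto simp: Bex_def)
  have "card D = (\<Sum>e\<in>?h ` D. card {d\<in>D. ?h d = e})"
    using sum.image_gen[OF finD, of "\<lambda>_. 1::nat" ?h] by simp
  also have "\<dots> = (\<Sum>e\<in>?h ` D. 2)"
  proof (rule sum.cong[OF refl])
    fix e assume "e \<in> ?h ` D"
    then obtain u v where e: "E u v" "e = {u, v}" using img Es_cases by metis
    have "{d\<in>D. ?h d = e} = {(u, v), (v, u)}"
      using e E_sym by (auto simp: doubleton_eq_iff)
    moreover have "u \<noteq> v" using e E_irr by auto
    ultimately show "card {d\<in>D. ?h d = e} = 2" by simp
  qed
  finally show ?thesis using img by simp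
qed

lemma fin_edges_at: "Z \<subseteq> Es \<Longrightarrow> finite {w. {v, w} \<in> Z}"
  by (rule finite_subset[OF _ fin_nbrs[of v]]) auto

section \<open>Boundaries and the cycle space over the two-element field\<close>

lemma oddv_sym_diff:
  assumes "Z1 \<subseteq> Es" "Z2 \<subseteq> Es"
  shows "oddv (sym_diff Z1 Z2) = sym_diff (oddv Z1) (oddv Z2)"
proof -
  have "{w. {v, w} \<in> sym_diff Z1 Z2} = sym_diff {w. {v, w} \<in> Z1} {w. {v, w} \<in> Z2}" for v by auto
  then have "even (card {w. {v, w} \<in> sym_diff Z1 Z2}) \<longleftrightarrow>
      (even (card {w. {v, w} \<in> Z1}) \<longleftrightarrow> even (card {w. {v, w} \<in> Z2}))" for v
    using even_card_sym_diff[OF fin_edges_at[OF assms(1)] fin_edges_at[OF assms(2)]] by presburger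
  then show ?thesis unfolding oddv_def by blast
qed

lemma oddv_edge: "E x y \<Longrightarrow> oddv {{x, y}} = {x, y}"
proof -
  assume xy: "E x y"
  then have ne: "x \<noteq> y" using E_irr by auto
  then have "{w. {v, w} = {x, y}} = (if v = x then {y} else if v = y then {x} else {})" for v
    by (auto simp: doubleton_eq_iff)
  then show ?thesis using xy E_V unfolding oddv_def by auto
qed

text \<open>The dart \<open>(w, v)\<close> is followed on its face by
  \<open>(v, \<sigma> v w)\<close>. So an edge at \<open>v\<close> lies in the boundary exactly when
  membership in \<open>S\<close> changes from \<open>w\<close> to its successor in the
  rotation.\<close>

lemma oddv_bd: "oddv (bd S) = {}"
proof -
  have "even (card {w. {v, w} \<in> bd S})" if v: "v \<in> V" for v
  proof -
    have "{w. {v, w} \<in> bd S} = {w\<in>nbrs E v. (F (v, w) \<in> S) \<noteq> (F (v, \<sigma> v w) \<in> S)}"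
      using F_rot E_sym unfolding bd_iff nbrs_def by fastforce
    then show ?thesis
      using even_card_changes_bij[of "nbrs E v" "\<sigma> v" "\<lambda>w. F (v, w) \<in> S"] fin_nbrs rot v
      unfolding nbrs_def rotation_system_def by simp
  qed
  then show ?thesis unfolding oddv_def by auto
qed

lemma bd_even: "even_edges (bd S)"
  using bd_sub oddv_bd unfolding even_edges_def by simp

lemma bd_sym_diff: "bd (sym_diff S T) = sym_diff (bd S) (bd T)"
proof (rule set_eqI)
  fix e
  show "e \<in> bd (sym_diff S T) \<longleftrightarrow> e \<in> sym_diff (bd S) (bd T)"
  proof (cases "e \<in> Es")
    case True
    then obtain u v where "e = {u, v}" using Es_cases by metis
    then show ?thesis unfolding Un_iff Diff_iff by (simp only: bd_iff) auto
  next
    case False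
    then show ?thesis using bd_sub by auto
  qed
qed

lemma rot_all:
  assumes v: "E v w" and P: "\<And>x. E v x \<Longrightarrow> P x \<Longrightarrow> P (\<sigma> v x)" and "P w" and w': "E v w'"
  shows "P w'"
proof -
  have vV: "v \<in> V" using v E_V by blast
  have "\<exists>n. (\<sigma> v ^^ n) w = w'"
    using rot v w' vV unfolding rotation_system_def nbrs_def by blast
  then obtain n where n: "(\<sigma> v ^^ n) w = w'" ..
  have "E v ((\<sigma> v ^^ k) w) \<and> P ((\<sigma> v ^^ k) w)" for k
  proof (induction k)
    case (Suc k)
    have "bij_betw (\<sigma> v) (nbrs E v) (nbrs E v)"
      using rot vV unfolding rotation_system_def by auto
    then have "E v (\<sigma> v ((\<sigma> v ^^ k) w))"
      using Suc unfolding bij_betw_def nbrs_def by auto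
    then show ?case using Suc P by auto
  qed (use assms in auto)
  then show ?thesis using n by blast
qed

text \<open>Without boundary edges, membership in \<open>S\<close> passes around every vertex and
  across every edge, hence by connectedness to all darts, those of \<open>Of\<close>
  included.\<close>

lemma bd_empty:
  assumes S: "S \<subseteq> faces V E \<sigma> - {Of}" and Z: "bd S = {}"
  shows "S = {}"
proof (rule ccontr)
  assume "S \<noteq> {}"
  then obtain u v where uv: "E u v" "F (u, v) \<in> S"
    using S unfolding faces_def by (force simp: darts_def)
  have flip: "F (x, y) \<in> S \<longleftrightarrow> F (y, x) \<in> S" if "E x y" for x y
    using Z that bd_iff[of x y S] by auto
  have all: "F (x, w') \<in> S" if "E x w" "F (x, w) \<in> S" "E x w'" for x w w'
    by (rule rot_all[of x w "\<lambda>w. F (x, w) \<in> S"]) (use that F_rot flip E_sym in auto)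
  obtain a b where ab: "E a b" "Of = F (a, b)"
    using Of_face unfolding faces_def by (force simp: darts_def)
  have "E\<^sup>*\<^sup>* u x \<Longrightarrow> \<forall>w. E x w \<longrightarrow> F (x, w) \<in> S" for x
  proof (induction rule: rtranclp_induct)
    case base
    then show ?case using all uv by blast
  next
    case (step x y)
    then have "F (y, x) \<in> S" using flip by blast
    then show ?case using all step E_sym by blast
  qed
  then have "Of \<in> S" using ab reach[of u a] uv E_V by auto
  then show False using S by auto
qed

lemma bd_inj: "inj_on bd (Pow (faces V E \<sigma> - {Of}))"
proof (rule inj_onI)
  fix S T assume ST: "S \<in> Pow (faces V E \<sigma> - {Of})" "T \<in> Pow (faces V E \<sigma> - {Of})" "bd S = bd T"
  then have "bd (sym_diff S T) = {}" using bd_sym_diff by auto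
  moreover have "sym_diff S T \<subseteq> faces V E \<sigma> - {Of}" using ST by auto
  ultimately have "sym_diff S T = {}" by (rule bd_empty[rotated])
  then show "S = T" by auto
qed

text \<open>A walk with its edges counted mod 2. The relation \<open>R\<close> is a parameter so
  that the walk can later be kept away from a cycle.\<close>

lemma join:
  assumes "R\<^sup>*\<^sup>* x y" and RE: "\<And>s t. R s t \<Longrightarrow> E s t"
  shows "\<exists>P. P \<subseteq> {{s, t} |s t. R s t} \<and> oddv P = sym_diff {x} {y}"
  using assms(1)
proof (induction rule: rtranclp_induct)
  case base
  show ?case by (intro exI[of _ "{}"]) (simp add: oddv_def)
next
  case (step y z)
  then obtain P where P: "P \<subseteq> {{s, t} |s t. R s t}" "oddv P = sym_diff {x} {y}" by blast
  have sub: "{{s, t} |s t. R s t} \<subseteq> Es" using RE unfolding Es_def by blast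
  have yz: "E y z" "y \<noteq> z" using RE step E_irr by blast+
  have "oddv (sym_diff P {{y, z}}) = sym_diff (sym_diff {x} {y}) {y, z}"
    using oddv_sym_diff[of P "{{y, z}}"] P sub oddv_edge yz by auto
  also have "\<dots> = sym_diff {x} {z}" using yz by auto
  finally show ?case
    using P step(2) by (intro exI[of _ "sym_diff P {{y, z}}"]) blast
qed

text \<open>Joining each prescribed vertex to the root \<open>v0\<close> makes it odd; the remaining
  parity is absorbed by \<open>v0\<close>.\<close>

lemma joins:
  assumes v0: "v0 \<in> V" and A: "finite A" "A \<subseteq> V - {v0}"
  shows "\<exists>P. P \<subseteq> Es \<and> oddv P - {v0} = A"
  using A
proof (induction A rule: finite_induct)
  case empty
  show ?case by (intro exI[of _ "{}"]) (simp add: oddv_def)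
next
  case (insert a A)
  then obtain P where P: "P \<subseteq> Es" "oddv P - {v0} = A" by blast
  obtain Q where Q: "Q \<subseteq> Es" "oddv Q = sym_diff {v0} {a}"
    using join[of E v0 a] reach[OF v0, of a] insert.prems unfolding Es_def by blast
  have "oddv (sym_diff P Q) = sym_diff (oddv P) (sym_diff {v0} {a})"
    using oddv_sym_diff[of P Q] P Q by auto
  then have "oddv (sym_diff P Q) - {v0} = insert a A" using P insert by blast
  then show ?case using P Q by (intro exI[of _ "sym_diff P Q"]) blast
qed

text \<open>The dimension bound |E| - |V| + 1 for the cycle space: adding the sets
  \<open>J A\<close> to even edge sets gives pairwise different edge sets, because the odd vertices
  off \<open>v0\<close> recover \<open>A\<close>.\<close>

lemma card_even_edges: "card {Z. even_edges Z} * 2 ^ (card V - 1) \<le> 2 ^ card Es"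
proof -
  obtain v0 where v0: "v0 \<in> V" using V_ne by blast
  have "\<forall>A\<in>Pow (V - {v0}). \<exists>P. P \<subseteq> Es \<and> oddv P - {v0} = A"
    using joins[OF v0] finV by (meson PowD finite_Diff finite_subset)
  then obtain J where J: "\<And>A. A \<in> Pow (V - {v0}) \<Longrightarrow> J A \<subseteq> Es \<and> oddv (J A) - {v0} = A"
    by metis
  let ?f = "\<lambda>(Z, A). sym_diff Z (J A)"
  let ?X = "{Z. even_edges Z} \<times> Pow (V - {v0})"
  have odd: "oddv (?f (Z, A)) - {v0} = A" if "even_edges Z" "A \<in> Pow (V - {v0})" for Z A
    using oddv_sym_diff[of Z "J A"] that J[of A] unfolding even_edges_def by auto
  have "inj_on ?f ?X"
  proof (rule inj_onI, clarify)
    fix Z A Z' A' assume h: "even_edges Z" "even_edges Z'" "A \<subseteq> V - {v0}" "A' \<subseteq> V - {v0}"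
      "sym_diff Z (J A) = sym_diff Z' (J A')"
    then have "A = A'" using odd[of Z A] odd[of Z' A'] by auto
    then show "Z = Z' \<and> A = A'" using h by blast
  qed
  moreover have "?f (Z, A) \<subseteq> Es" if "even_edges Z" "A \<in> Pow (V - {v0})" for Z A
    using that J[of A] unfolding even_edges_def by auto
  then have "?f ` ?X \<subseteq> Pow Es" by blast
  ultimately have "card ?X \<le> card (Pow Es)"
    using card_inj_on_le finEs by blast
  then show ?thesis using v0 finV finEs by (simp add: card_cartesian_product card_Pow)
qed

lemma fin_faces: "finite (faces V E \<sigma>)"
  using finD unfolding faces_def by simp

text \<open>Injectivity of \<open>bd\<close> yields one boundary for each set of internal faces.
  Euler's formula equates |F| - 1 with the dimension bound for the cycle space, so no even edge set
  is left over.\<close>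

lemma even_edges_bd:
  assumes "even_edges Z"
  shows "\<exists>S. S \<subseteq> faces V E \<sigma> - {Of} \<and> bd S = Z"
proof -
  let ?P = "Pow (faces V E \<sigma> - {Of})"
  have pos: "card V > 0" "card (faces V E \<sigma>) > 0"
    using V_ne finV fin_faces Of_face by (auto simp: card_gt_0_iff)
  then have exps: "(card (faces V E \<sigma>) - 1) + (card V - 1) = card Es"
    using euler card_darts by linarith
  have "card {Z. even_edges Z} * 2 ^ (card V - 1) \<le> 2 ^ (card (faces V E \<sigma>) - 1) * 2 ^ (card V - 1)"
    using card_even_edges exps by (simp add: power_add[symmetric])
  then have "card {Z. even_edges Z} \<le> 2 ^ (card (faces V E \<sigma>) - 1)" by simp
  also have "\<dots> = card (bd ` ?P)"
    using card_image[OF bd_inj] fin_faces Of_face by (simp add: card_Pow)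
  finally have le: "card {Z. even_edges Z} \<le> card (bd ` ?P)" .
  have fin: "finite {Z. even_edges Z}"
    by (rule finite_subset[of _ "Pow Es"]) (use finEs in \<open>auto simp: even_edges_def\<close>)
  have "bd ` ?P = {Z. even_edges Z}"
    by (rule card_seteq[OF fin _ le]) (use bd_even in auto)
  then have "Z \<in> bd ` ?P" using assms by simp
  then show ?thesis by auto
qed

section \<open>The inside of an even edge set\<close>

lemma ins_bd: "S \<subseteq> faces V E \<sigma> - {Of} \<Longrightarrow> ins (bd S) d \<longleftrightarrow> F d \<in> S"
  using inj_onD[OF bd_inj] unfolding ins_def by (metis PowI)

lemma ins_edge: "even_edges Z \<Longrightarrow> E u v \<Longrightarrow> ins Z (u, v) \<noteq> ins Z (v, u) \<longleftrightarrow> {u, v} \<in> Z"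
  using even_edges_bd[of Z] ins_bd[of _ "(u, v)"] ins_bd[of _ "(v, u)"] bd_iff[of u v] by metis

lemma ins_face: "F d = F d' \<Longrightarrow> ins Z d \<longleftrightarrow> ins Z d'"
  unfolding ins_def by simp

lemma Of_F: "d \<in> Of \<Longrightarrow> d \<in> D \<and> F d = Of"
  using Of_face F_eq F_sub unfolding faces_def by blast

lemma ins_Of: "d \<in> Of \<Longrightarrow> \<not> ins Z d"
  using Of_F unfolding ins_def by blast

lemma ins_sym_diff:
  assumes "even_edges Z1" "even_edges Z2"
  shows "ins (sym_diff Z1 Z2) d \<longleftrightarrow> ins Z1 d \<noteq> ins Z2 d"
proof -
  obtain S1 S2 where S: "S1 \<subseteq> faces V E \<sigma> - {Of}" "bd S1 = Z1" "S2 \<subseteq> faces V E \<sigma> - {Of}" "bd S2 = Z2"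
    using assms even_edges_bd by metis
  then have "ins (bd (sym_diff S1 S2)) d \<longleftrightarrow> F d \<in> sym_diff S1 S2"
    by (intro ins_bd) blast
  then show ?thesis using ins_bd[of S1 d] ins_bd[of S2 d] S bd_sym_diff by auto
qed

lemma even_sym_diff: "even_edges Z1 \<Longrightarrow> even_edges Z2 \<Longrightarrow> even_edges (sym_diff Z1 Z2)"
  using oddv_sym_diff unfolding even_edges_def by auto

text \<open>Some dart at \<open>v\<close> belongs to the unbounded face, and turning around
  \<open>v\<close> crosses no edge of \<open>Z\<close>, so all darts at \<open>v\<close> stay
  outside.\<close>

lemma ins_untouched:
  assumes Z: "even_edges Z" and vw: "E v w" and un: "\<And>x. {v, x} \<notin> Z"
  shows "\<not> ins Z (v, w)"
proof -
  obtain w0 where w0: "(v, w0) \<in> Of" using on_Of vw E_V by blast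
  then have vw0: "E v w0" using Of_F by force
  show ?thesis
  proof (rule rot_all[OF vw0 _ _ vw])
    show "\<not> ins Z (v, w0)" using w0 ins_Of by blast
    show "\<not> ins Z (v, \<sigma> v x)" if "E v x" "\<not> ins Z (v, x)" for x
      using that ins_edge[OF Z that(1)] un ins_face[OF F_rot[of x v]] E_sym by blast
  qed
qed

section \<open>Induced cycles and internal faces\<close>

text \<open>\<open>cyc C\<close>: \<open>C\<close> is the vertex set of an induced cycle. Edge sets are added mod 2, also in \<open>arc\<close>, so
  that telescoping needs no injectivity.\<close>

definition cyc :: "'a set \<Rightarrow> bool" where
  "cyc C \<longleftrightarrow> C \<subseteq> V \<and> C \<noteq> {} \<and> (\<forall>v\<in>C. card {w\<in>C. E v w} = 2)
     \<and> (\<forall>u\<in>C. \<forall>v\<in>C. (\<lambda>x y. E x y \<and> x \<in> C \<and> y \<in> C)\<^sup>*\<^sup>* u v)"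

definition cedges :: "'a set \<Rightarrow> 'a set set" where
  "cedges C = {{u, v} |u v. E u v \<and> u \<in> C \<and> v \<in> C}"

definition cface :: "'a set \<Rightarrow> ('a \<times> 'a) set" where
  "cface C = {d\<in>D. ins (cedges C) d}"

text \<open>A periodic enumeration on all natural numbers avoids modular indices in
  \<open>arc\<close>; neighbours are described at \<open>Suc i\<close> so that no predecessor of 0
  is needed.\<close>

definition cycmap :: "(nat \<Rightarrow> 'a) \<Rightarrow> 'a set \<Rightarrow> bool" where
  "cycmap c C \<longleftrightarrow> (\<forall>i. c (i + card C) = c i) \<and> inj_on c {..<card C} \<and> c ` {..<card C} = C
     \<and> (\<forall>i. {w\<in>C. E (c (Suc i)) w} = {c i, c (Suc (Suc i))})"

primrec arc :: "(nat \<Rightarrow> 'a) \<Rightarrow> nat \<Rightarrow> nat \<Rightarrow> 'a set set" where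
  "arc c i 0 = {}"
| "arc c i (Suc m) = sym_diff (arc c i m) {{c (i + m), c (Suc (i + m))}}"

text \<open>The intended case is \<open>k \<notin> C\<close>; for \<open>k \<in> C\<close> no step
  is possible and the value is \<open>{k}\<close>.\<close>

definition component :: "'a set \<Rightarrow> 'a \<Rightarrow> 'a set" where
  "component C k = {w. (\<lambda>x y. E x y \<and> x \<notin> C \<and> y \<notin> C)\<^sup>*\<^sup>* k w}"

definition att :: "'a set \<Rightarrow> 'a \<Rightarrow> 'a set" where
  "att C k = {a\<in>C. \<exists>x\<in>component C k. E x a}"

section \<open>The inside of an induced cycle\<close>

lemma cedges_iff: "{u, v} \<in> cedges C \<longleftrightarrow> E u v \<and> u \<in> C \<and> v \<in> C"
  using E_sym unfolding cedges_def by (auto simp: doubleton_eq_iff)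

lemma cyc_V: "cyc C \<Longrightarrow> v \<in> C \<Longrightarrow> v \<in> V"
  unfolding cyc_def by blast

lemma cyc_fin: "cyc C \<Longrightarrow> finite C"
  using finV finite_subset unfolding cyc_def by blast

lemma cyc_nbrs: "cyc C \<Longrightarrow> v \<in> C \<Longrightarrow> \<exists>p q. p \<noteq> q \<and> {w\<in>C. E v w} = {p, q}"
  unfolding cyc_def by (meson card_2_iff)

lemma cedges_even: "cyc C \<Longrightarrow> even_edges (cedges C)"
proof -
  assume C: "cyc C"
  have "{w. {v, w} \<in> cedges C} = (if v \<in> C then {w\<in>C. E v w} else {})" for v
    by (auto simp: cedges_iff)
  then show ?thesis
    using C unfolding even_edges_def oddv_def cyc_def by (auto simp: cedges_def Es_def)
qed

text \<open>\<open>ins_untouched\<close> puts the start of an enclosed dart on the cycle; its end is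
  the start of the next dart of the same face, which is enclosed as well.\<close>

lemma cface_vertices:
  assumes C: "cyc C" and uv: "(u, v) \<in> cface C"
  shows "E u v" "u \<in> C" "v \<in> C"
proof -
  have *: "E u v" "ins (cedges C) (u, v)" using uv unfolding cface_def by auto
  then show "E u v" by simp
  show "u \<in> C"
    using ins_untouched[OF cedges_even[OF C] *(1)] *(2) cedges_iff by blast
  have "E v (\<sigma> v u)" "ins (cedges C) (v, \<sigma> v u)"
    using fs_D[of "(u, v)"] * ins_face[OF F_rot[OF *(1)]] by (auto simp: face_step_def)
  then show "v \<in> C"
    using ins_untouched[OF cedges_even[OF C]] cedges_iff by blast
qed

lemma cface_swap:
  assumes "cyc C" "E u v" "u \<in> C" "v \<in> C"
  shows "(u, v) \<in> cface C \<longleftrightarrow> (v, u) \<notin> cface C"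
  using ins_edge[OF cedges_even[OF assms(1)] assms(2)] assms cedges_iff[of u v C] E_sym unfolding cface_def by auto

lemma cface_step: "d \<in> D \<Longrightarrow> fs d \<in> cface C \<longleftrightarrow> d \<in> cface C"
  using ins_face[OF F_step] fs_D unfolding cface_def by blast

lemma cface_pred:
  assumes "cyc C" "(v, w) \<in> cface C"
  shows "\<exists>u. (u, v) \<in> cface C \<and> fs (u, v) = (v, w)"
proof -
  obtain d where d: "d \<in> D" "fs d = (v, w)" using fs_surj assms unfolding cface_def by blast
  then have "snd d = v" unfolding face_step_def by auto
  then have "d = (fst d, v)" by (cases d) auto
  then show ?thesis using cface_step[OF d(1), of C] d assms by metis
qed

lemma cface_succ:
  assumes "cyc C" "(u, v) \<in> cface C"
  shows "\<exists>w. (v, w) \<in> cface C \<and> fs (u, v) = (v, w)"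
  using cface_step[of "(u, v)" C] assms unfolding face_step_def cface_def by auto

text \<open>The face cannot turn back at \<open>v\<close>, because only one of the two darts of a
  cycle edge is enclosed. So arrival and departure use up both neighbours of \<open>v\<close> on
  \<open>C\<close>.\<close>

lemma cface_nbrs:
  assumes C: "cyc C" and uv: "(u, v) \<in> cface C" and vw: "(v, w) \<in> cface C"
  shows "u \<noteq> w" "{x\<in>C. E v x} = {u, w}"
proof -
  note 1 = cface_vertices[OF C uv] and 2 = cface_vertices[OF C vw]
  show ne: "u \<noteq> w" using cface_swap[OF C, of u v] 1 uv vw by blast
  obtain p q where "p \<noteq> q" "{x\<in>C. E v x} = {p, q}" using cyc_nbrs[OF C 1(3)] by blast
  moreover have "u \<in> {x\<in>C. E v x}" "w \<in> {x\<in>C. E v x}" using 1 2 E_sym by auto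
  ultimately show "{x\<in>C. E v x} = {u, w}" using ne by auto
qed

lemma cface_from:
  assumes C: "cyc C" and v: "v \<in> C"
  shows "\<exists>w. (v, w) \<in> cface C"
proof -
  obtain p q where pq: "{x\<in>C. E v x} = {p, q}" using cyc_nbrs[OF C v] by blast
  then have p: "p \<in> C" "E v p" by auto
  then have "(v, p) \<in> cface C \<or> (p, v) \<in> cface C" using cface_swap[OF C p(2) v p(1)] by blast
  then show ?thesis using cface_succ[OF C] by blast
qed

lemma cface_inj:
  assumes C: "cyc C" and "(v, w) \<in> cface C" "(v, w') \<in> cface C"
  shows "w = w'"
proof -
  obtain u where u: "(u, v) \<in> cface C" using cface_pred assms by blast
  from cface_nbrs[OF C u assms(2)] cface_nbrs[OF C u assms(3)]
  show ?thesis by (metis doubleton_eq_iff)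
qed

lemma cface_fst:
  assumes "cyc C" shows "fst ` cface C = C"
proof
  show "fst ` cface C \<subseteq> C" using cface_vertices(2)[OF assms] by auto
  show "C \<subseteq> fst ` cface C" using cface_from[OF assms] by (metis fst_conv image_eqI subsetI)
qed

lemma cface_fst_inj: "cyc C \<Longrightarrow> inj_on fst (cface C)"
  by (rule inj_onI) (metis cface_inj prod.collapse)

lemma card_cface: "cyc C \<Longrightarrow> card (cface C) = card C"
  using card_image[OF cface_fst_inj] cface_fst by fastforce

text \<open>Both neighbours of \<open>v\<close> on \<open>C\<close> are the previous and the next
  vertex on the orbit, so the visited vertices are closed under adjacency in \<open>C\<close> and
  exhaust it by connectedness. As each vertex starts only one enclosed dart, a single orbit contains
  them all.\<close>

lemma cface_orbit:
  assumes C: "cyc C" and d: "d \<in> cface C"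
  shows "F d = cface C"
proof
  have dD: "d \<in> D" using d unfolding cface_def by simp
  show sub: "F d \<subseteq> cface C"
    using F_eq[OF dD] F_sub[OF dD] ins_face[of _ d] d unfolding cface_def by blast
  have step: "x \<in> fst ` F d" if v: "v \<in> fst ` F d" and x: "x \<in> C" "E v x" for v x
  proof -
    obtain w where w: "(v, w) \<in> F d" using v by auto
    then have wc: "(v, w) \<in> cface C" using sub by blast
    obtain u where u: "(u, v) \<in> cface C" "fs (u, v) = (v, w)" using cface_pred[OF C wc] by blast
    obtain z where z: "fs (v, w) = (w, z)" using cface_succ[OF C wc] by blast
    have "F (u, v) = F d" "F (w, z) = F d"
      using F_step[of "(u, v)"] F_step[of "(v, w)"] F_eq[OF dD w] u z wc unfolding cface_def by auto
    then have "u \<in> fst ` F d" "w \<in> fst ` F d" using F_refl[of "(u, v)"] F_refl[of "(w, z)"] by force+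
    then show ?thesis using cface_nbrs(2)[OF C u(1) wc] x by blast
  qed
  show "cface C \<subseteq> F d"
  proof
    fix d' assume d': "d' \<in> cface C"
    have fC: "fst d \<in> C" "fst d' \<in> C" using d d' cface_fst[OF C] by auto
    have "(\<lambda>x y. E x y \<and> x \<in> C \<and> y \<in> C)\<^sup>*\<^sup>* (fst d) (fst d')"
      using C fC unfolding cyc_def by blast
    then have "fst d' \<in> fst ` F d"
      by (induction rule: rtranclp_induct) (use F_refl step in auto)
    then obtain d1 where "d1 \<in> F d" "fst d1 = fst d'" by auto
    then show "d' \<in> F d" using cface_fst_inj[OF C] d' sub by (metis inj_onD subsetD)
  qed
qed

lemma cface_internal: "cyc C \<Longrightarrow> cface C \<in> internal_faces V E \<sigma> Of"
proof -
  assume C: "cyc C"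
  then obtain v where "v \<in> C" unfolding cyc_def by blast
  then obtain w where vw: "(v, w) \<in> cface C" using cface_from C by blast
  then have "(v, w) \<in> D" unfolding cface_def by simp
  then have "cface C \<in> faces V E \<sigma>"
    using cface_orbit[OF C vw] unfolding faces_def by (metis imageI)
  moreover have "cface C \<noteq> Of" using vw ins_Of unfolding cface_def by blast
  ultimately show ?thesis unfolding internal_faces_def by blast
qed

text \<open>Tracing the inner face from a dart at \<open>a\<close> enumerates the cycle; the least
  period is the number of darts of that face, which is \<open>card C\<close>.\<close>

lemma cycmap_ex:
  assumes C: "cyc C" and a: "a \<in> C"
  shows "\<exists>c. cycmap c C \<and> c 0 = a"
proof -
  obtain w where w: "(a, w) \<in> cface C" using cface_from[OF C a] by blast
  let ?d = "\<lambda>k. (fs ^^ k) (a, w)"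
  define c where "c k = fst (?d k)" for k
  have aD: "(a, w) \<in> D" using w unfolding cface_def by simp
  have dk: "?d k \<in> cface C" for k
    using cface_orbit[OF C w] unfolding face_of_def by blast
  have dk2: "?d k = (c k, c (Suc k))" for k
    unfolding c_def by (simp add: face_step_def prod_eq_iff)
  define n where "n = (LEAST n. n > 0 \<and> ?d n = ?d 0)"
  have n: "n > 0" "?d n = ?d 0"
    using LeastI_ex[of "\<lambda>n. n > 0 \<and> ?d n = ?d 0"] period[OF aD] unfolding n_def by auto
  have min: "n \<le> k" if "k > 0" "?d k = ?d 0" for k
    using Least_le[of "\<lambda>n. n > 0 \<and> ?d n = ?d 0" k] that unfolding n_def by auto
  have cancel: "?d i = ?d (i + k) \<Longrightarrow> ?d 0 = ?d k" for i k
  proof (induction i)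
    case (Suc i)
    have "?d i \<in> D" "?d (i + k) \<in> D" using dk unfolding cface_def by blast+
    then have "?d i = ?d (i + k)" using Suc.prems fs_inj by (simp add: inj_on_eq_iff)
    then show ?case by (rule Suc.IH)
  qed simp
  have injd: "inj_on ?d {..<n}"
  proof (rule linorder_inj_onI')
    fix i j assume ij: "i \<in> {..<n}" "j \<in> {..<n}" "i < j"
    show "?d i \<noteq> ?d j"
      using cancel[of i "j - i"] min[of "j - i"] ij by force
  qed
  have mod: "?d k = ?d (k mod n)" for k
    using funpow_mod_eq[of n fs "(a, w)" k] n by simp
  have "?d ` {..<n} = cface C"
  proof
    show "cface C \<subseteq> ?d ` {..<n}"
    proof
      fix d assume "d \<in> cface C"
      then obtain k where "d = ?d k" using cface_orbit[OF C w] unfolding face_of_def by auto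
      then show "d \<in> ?d ` {..<n}" using mod[of k] n by auto
    qed
  qed (use dk in auto)
  then have img: "?d ` {..<n} = cface C" .
  then have nC: "n = card C" using card_image[OF injd] card_cface[OF C] by simp
  have c: "c = fst \<circ> ?d" unfolding c_def by auto
  have "inj_on c {..<n}"
    unfolding c using injd cface_fst_inj[OF C] img by (metis comp_inj_on)
  moreover have "c ` {..<n} = C" unfolding c image_comp[symmetric] img by (rule cface_fst[OF C])
  moreover have "c (i + n) = c i" for i
    unfolding c_def using mod[of i] mod[of "i + n"] by simp
  moreover have "{w\<in>C. E (c (Suc i)) w} = {c i, c (Suc (Suc i))}" for i
    by (rule cface_nbrs(2)[OF C]) (use dk dk2 in metis)+
  ultimately have "cycmap c C" unfolding cycmap_def nC by blast
  moreover have "c 0 = a" unfolding c_def by simp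
  ultimately show ?thesis by blast
qed

lemma cycmap_edge: "cycmap c C \<Longrightarrow> E (c i) (c (Suc i))"
  using E_sym unfolding cycmap_def by blast

lemma cycmap_in: "cycmap c C \<Longrightarrow> c i \<in> C"
  unfolding cycmap_def by blast

lemma cyc_card: "cyc C \<Longrightarrow> 3 \<le> card C"
proof -
  assume C: "cyc C"
  then obtain v where v: "v \<in> C" unfolding cyc_def by blast
  obtain p q where pq: "p \<noteq> q" "{w\<in>C. E v w} = {p, q}" using cyc_nbrs[OF C v] by blast
  then have "{v, p, q} \<subseteq> C" "v \<noteq> p" "v \<noteq> q" using v E_irr by blast+
  then show ?thesis using card_mono[OF cyc_fin[OF C], of "{v, p, q}"] pq(1) by simp
qed

section \<open>Arcs and closed walks\<close>

lemma arc_sub: "(\<And>k. E (c k) (c (Suc k))) \<Longrightarrow> arc c i m \<subseteq> Es"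
  by (induction m) auto

lemma oddv_arc:
  assumes E: "\<And>k. E (c k) (c (Suc k))"
  shows "oddv (arc c i m) = sym_diff {c i} {c (i + m)}"
proof (induction m)
  case 0
  show ?case by (simp add: oddv_def)
next
  case (Suc m)
  have "oddv (arc c i (Suc m)) = sym_diff (sym_diff {c i} {c (i + m)}) {c (i + m), c (Suc (i + m))}"
    using oddv_sym_diff[OF arc_sub[of c, OF E], of "{{c (i + m), c (Suc (i + m))}}" i m] Suc
      oddv_edge[OF E, of "i + m"] E by simp
  also have "\<dots> = sym_diff {c i} {c (i + Suc m)}"
    using E[of "i + m"] E_irr[of "c (i + m)"] by (cases "c i = c (i + m)"; cases "c i = c (Suc (i + m))") auto
  finally show ?case .
qed

lemma arc_touch: "{v, w} \<in> arc c i m \<Longrightarrow> \<exists>k. i \<le> k \<and> k \<le> i + m \<and> v = c k"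
proof (induction m)
  case (Suc m)
  then consider "{v, w} \<in> arc c i m" | "{v, w} = {c (i + m), c (Suc (i + m))}" by auto
  then show ?case
  proof cases
    case 1
    then show ?thesis using Suc.IH le_SucI by force
  next
    case 2
    then have "v = c (i + m) \<or> v = c (Suc (i + m))" by auto
    then show ?thesis by (metis add_Suc_right le_add1 le_Suc_eq order_refl)
  qed
qed simp

lemma arc_append: "sym_diff (arc c i m) (arc c (i + m) k) = arc c i (m + k)"
proof (induction k)
  case (Suc k)
  have "sym_diff (arc c i m) (arc c (i + m) (Suc k)) =
      sym_diff (sym_diff (arc c i m) (arc c (i + m) k)) {{c (i + m + k), c (Suc (i + m + k))}}"
    by (simp only: arc.simps) blast
  then show ?case unfolding Suc by (simp add: add.assoc)
qed simp

lemma card_arc: "finite (arc c i m) \<and> card (arc c i m) \<le> m"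
proof (induction m)
  case (Suc m)
  have "card (sym_diff (arc c i m) {x}) \<le> card (arc c i m \<union> {x})" for x
    using Suc by (intro card_mono) auto
  moreover have "card (arc c i m \<union> {x}) \<le> card (arc c i m) + 1" for x
    using card_Un_le[of "arc c i m" "{x}"] by simp
  ultimately have "card (sym_diff (arc c i m) {x}) \<le> card (arc c i m) + 1" for x
    using le_trans by blast
  then have "card (sym_diff (arc c i m) {x}) \<le> Suc m" for x
    using Suc by (simp add: le_trans[where j="card (arc c i m) + 1"])
  then show ?case using Suc by simp
qed simp

text \<open>No edge is repeated, so nothing cancels in the sum mod 2. With \<open>n = 2\<close> both
  steps would use the same edge.\<close>

lemma closed_arc:
  assumes n: "3 \<le> n" and inj: "inj_on p {..<n}" and p: "p n = p 0"
  shows "inj_on (\<lambda>k. {p k, p (Suc k)}) {..<n}"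
    "arc p 0 n = (\<lambda>k. {p k, p (Suc k)}) ` {..<n}"
proof -
  have ne: "{p k, p (Suc k)} \<noteq> {p j, p (Suc j)}" if "k < j" "j < n" for k j
  proof
    assume "{p k, p (Suc k)} = {p j, p (Suc j)}"
    moreover have "p k \<noteq> p j" using inj that by (auto simp: inj_on_def)
    ultimately have eq: "p k = p (Suc j)" "p (Suc k) = p j" by (auto simp: doubleton_eq_iff)
    show False
    proof (cases "Suc j = n")
      case True
      then have "k = 0" using eq p inj that by (auto simp: inj_on_def)
      moreover have "Suc k = j" using eq inj that by (auto simp: inj_on_def)
      ultimately show False using True n by simp
    next
      case False
      then have "Suc j = k" using eq inj that by (auto simp: inj_on_def)
      then show False using that by simp
    qed
  qed
  then show "inj_on (\<lambda>k. {p k, p (Suc k)}) {..<n}"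
    by (intro linorder_inj_onI') auto
  have "m \<le> n \<Longrightarrow> arc p 0 m = (\<lambda>k. {p k, p (Suc k)}) ` {..<m}" for m
  proof (induction m)
    case (Suc m)
    then have "{p m, p (Suc m)} \<notin> (\<lambda>k. {p k, p (Suc k)}) ` {..<m}"
      using ne[of _ m] by (metis (no_types, lifting) Suc_le_lessD imageE lessThan_iff)
    then show ?case using Suc by (auto simp: lessThan_Suc)
  qed simp
  then show "arc p 0 n = (\<lambda>k. {p k, p (Suc k)}) ` {..<n}" by simp
qed

lemma chordless_closed_walk:
  assumes n: "3 \<le> n" and inj: "inj_on p {..<n}" and p: "p n = p 0"
    and E: "\<And>k. k < n \<Longrightarrow> E (p k) (p (Suc k))"
    and chord: "\<And>s t. s < t \<Longrightarrow> t < n \<Longrightarrow> E (p s) (p t) \<Longrightarrow> t = Suc s \<or> (s = 0 \<and> t = n - 1)"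
  shows "cyc (p ` {..<n})" "cedges (p ` {..<n}) = (\<lambda>k. {p k, p (Suc k)}) ` {..<n}"
    "card (p ` {..<n}) = n"
proof -
  let ?C = "p ` {..<n}"
  have E0: "E (p (n - 1)) (p 0)" using E[of "n - 1"] n p by simp
  have in1: "p (Suc k) \<in> ?C" if "k < n" for k
    using that p n by (cases "Suc k = n") auto
  \<comment> \<open>\<open>n - 1\<close> is the cyclic predecessor of 0; the successor of
    \<open>n - 1\<close> needs no case of its own because \<open>p n = p 0\<close>.\<close>
  have nb: "{w\<in>?C. E (p k) w} = {p (Suc k), p (if k = 0 then n - 1 else k - 1)}" if k: "k < n" for k
  proof
    show "{w\<in>?C. E (p k) w} \<subseteq> {p (Suc k), p (if k = 0 then n - 1 else k - 1)}"
    proof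
      fix w assume "w \<in> {w\<in>?C. E (p k) w}"
      then obtain j where j: "j < n" "w = p j" "E (p k) (p j)" by auto
      then have "k \<noteq> j" using E_irr by auto
      then consider "k < j" | "j < k" by linarith
      then show "w \<in> {p (Suc k), p (if k = 0 then n - 1 else k - 1)}"
      proof cases
        case 1
        then show ?thesis using chord[of k j] j by auto
      next
        case 2
        then have "k = Suc j \<or> (j = 0 \<and> k = n - 1)" using chord[of j k] j k E_sym by blast
        then show ?thesis using j p n by (auto simp: Suc_diff_Suc numeral_eq_Suc)
      qed
    qed
    have "E (p k) (p (if k = 0 then n - 1 else k - 1))"
      using E[of "k - 1"] E0 E_sym k by auto
    then show "{p (Suc k), p (if k = 0 then n - 1 else k - 1)} \<subseteq> {w\<in>?C. E (p k) w}"
      using E[OF k] in1[OF k] k n by auto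
  qed
  have ne: "p (Suc k) \<noteq> p (if k = 0 then n - 1 else k - 1)" if k: "k < n" for k
  proof (cases "Suc k = n")
    case True
    moreover have "p 0 \<noteq> p (k - 1)" using True n inj_onD[OF inj, of 0 "k - 1"] by fastforce
    ultimately show ?thesis using p n by auto
  next
    case False
    then have "Suc k < n" using k by simp
    moreover have "Suc k \<noteq> (if k = 0 then n - 1 else k - 1)" using n by auto
    moreover have "(if k = 0 then n - 1 else k - 1) < n" using n k by auto
    ultimately show ?thesis using inj unfolding inj_on_def by blast
  qed
  define R where "R = (\<lambda>x y. E x y \<and> x \<in> ?C \<and> y \<in> ?C)"
  have c1: "k < n \<Longrightarrow> R\<^sup>*\<^sup>* (p 0) (p k)" for k
  proof (induction k)
    case (Suc k)
    then have "R (p k) (p (Suc k))" using E unfolding R_def by auto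
    then show ?case using Suc rtranclp.rtrancl_into_rtrancl[of R] Suc_lessD by metis
  qed simp
  have c2: "k < n \<Longrightarrow> R\<^sup>*\<^sup>* (p k) (p 0)" for k
  proof (induction k)
    case (Suc k)
    then have "R (p (Suc k)) (p k)" using E E_sym unfolding R_def by auto
    then show ?case using Suc converse_rtranclp_into_rtranclp[of R] Suc_lessD by metis
  qed simp
  show "cyc ?C"
    unfolding cyc_def
  proof (intro conjI ballI)
    show "?C \<subseteq> V" using E E_V by blast
    show "?C \<noteq> {}" using n by (auto simp: lessThan_empty_iff)
    show "card {w\<in>?C. E v w} = 2" if v: "v \<in> ?C" for v
    proof -
      obtain k where k: "k < n" "v = p k" using v by auto
      show ?thesis unfolding k(2) nb[OF k(1)] using ne[OF k(1)] by (rule card_2_iff[THEN iffD2, OF exI, OF exI, OF conjI[OF refl]])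
    qed
    show "(\<lambda>x y. E x y \<and> x \<in> ?C \<and> y \<in> ?C)\<^sup>*\<^sup>* u v" if "u \<in> ?C" "v \<in> ?C" for u v
      using that c1 c2 rtranclp_trans[of R] unfolding R_def[symmetric] by blast
  qed
  show "cedges ?C = (\<lambda>k. {p k, p (Suc k)}) ` {..<n}"
  proof
    show "(\<lambda>k. {p k, p (Suc k)}) ` {..<n} \<subseteq> cedges ?C"
      using E in1 cedges_iff by auto
    show "cedges ?C \<subseteq> (\<lambda>k. {p k, p (Suc k)}) ` {..<n}"
    proof
      fix e assume "e \<in> cedges ?C"
      then obtain k w where k: "k < n" "e = {p k, w}" "w \<in> ?C" "E (p k) w"
        unfolding cedges_def by blast
      then have "w \<in> {p (Suc k), p (if k = 0 then n - 1 else k - 1)}" using nb by blast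
      then consider "w = p (Suc k)" | "k = 0" "w = p (n - 1)" | "k > 0" "w = p (k - 1)"
        by (auto split: if_splits)
      then show "e \<in> (\<lambda>k. {p k, p (Suc k)}) ` {..<n}"
      proof cases
        case 1
        then show ?thesis using k by auto
      next
        case 2
        then have "e = {p (n - 1), p (Suc (n - 1))}" using k p n by auto
        then show ?thesis using n by (intro image_eqI[of _ _ "n - 1"]) auto
      next
        case 3
        then have "e = {p (k - 1), p (Suc (k - 1))}" using k by auto
        then show ?thesis using k by (intro image_eqI[of _ _ "k - 1"]) auto
      qed
    qed
  qed
  show "card ?C = n" using card_image[OF inj] by simp
qed

lemma cycmap_mod: "cycmap c C \<Longrightarrow> c (i mod card C) = c i"
proof -
  assume c: "cycmap c C"
  have "c (j + k * card C) = c j" for j k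
  proof (induction k)
    case (Suc k)
    have "c (j + Suc k * card C) = c ((j + k * card C) + card C)" by (simp add: algebra_simps)
    then show ?case using Suc c unfolding cycmap_def by simp
  qed simp
  from this[of "i mod card C" "i div card C"] show ?thesis by simp
qed

lemma cycmap_arc:
  assumes C: "cyc C" and c: "cycmap c C"
  shows "arc c 0 (card C) = cedges C"
proof -
  let ?n = "card C"
  have n: "3 \<le> ?n" using cyc_card[OF C] .
  have c': "inj_on c {..<?n}" "c ?n = c 0" "c ` {..<?n} = C"
    using c unfolding cycmap_def by (blast, metis add_0, blast)
  have arc: "arc c 0 ?n = (\<lambda>k. {c k, c (Suc k)}) ` {..<?n}"
    by (rule closed_arc(2)[OF n c'(1,2)])
  have edge: "{c k, c (Suc k)} \<in> arc c 0 ?n" for k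
  proof -
    have "c (Suc k) = c (Suc (k mod ?n))"
      using cycmap_mod[OF c, of "Suc k"] cycmap_mod[OF c, of "Suc (k mod ?n)"] by (simp add: mod_Suc_eq)
    then have "{c k, c (Suc k)} = {c (k mod ?n), c (Suc (k mod ?n))}" using cycmap_mod[OF c] by simp
    moreover have "k mod ?n < ?n" using n by simp
    ultimately show ?thesis unfolding arc by blast
  qed
  show ?thesis
  proof
    show "arc c 0 ?n \<subseteq> cedges C"
      unfolding arc using cycmap_edge[OF c] cycmap_in[OF c] cedges_iff by auto
    show "cedges C \<subseteq> arc c 0 ?n"
    proof
      fix e assume "e \<in> cedges C"
      then obtain u v where uv: "e = {u, v}" "u \<in> C" "v \<in> C" "E u v" unfolding cedges_def by blast
      then obtain k where "u = c k" using c'(3) by blast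
      \<comment> \<open>A shift by a full period gives every vertex an index that has a
        predecessor.\<close>
      then have "u = c (Suc (k + (?n - 1)))"
        using c n unfolding cycmap_def by (metis Suc_pred' add_Suc_right diff_Suc_1 gr_zeroI not_numeral_le_zero)
      then obtain j where j: "u = c (Suc j)" by blast
      then have "v = c j \<or> v = c (Suc (Suc j))" using c uv unfolding cycmap_def by blast
      then show "e \<in> arc c 0 ?n" using edge[of j] edge[of "Suc j"] j uv by (auto simp: insert_commute)
    qed
  qed
qed

section \<open>Components off a cycle and their attachments\<close>

lemma component_refl: "k \<in> component C k"
  unfolding component_def by simp

lemma component_notin: "k \<notin> C \<Longrightarrow> x \<in> component C k \<Longrightarrow> x \<notin> C"
  unfolding component_def by (auto elim: rtranclp.cases)

lemma component_step: "k \<notin> C \<Longrightarrow> x \<in> component C k \<Longrightarrow> E x y \<Longrightarrow> y \<notin> C \<Longrightarrow> y \<in> component C k"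
  using component_notin unfolding component_def by (metis (mono_tags, lifting) mem_Collect_eq rtranclp.rtrancl_into_rtrancl)

lemma component_least:
  assumes "k \<in> K" "\<And>x y. x \<in> K \<Longrightarrow> E x y \<Longrightarrow> y \<notin> C \<Longrightarrow> y \<in> K"
  shows "component C k \<subseteq> K"
proof
  fix x assume "x \<in> component C k"
  then have "(\<lambda>x y. E x y \<and> x \<notin> C \<and> y \<notin> C)\<^sup>*\<^sup>* k x" unfolding component_def by simp
  then show "x \<in> K" by (induction rule: rtranclp_induct) (use assms in auto)
qed

lemma component_sym:
  assumes "k \<notin> C" "x \<in> component C k"
  shows "component C x = component C k"
proof -
  have "component C x \<subseteq> component C k" using component_least component_step assms by metis
  moreover have "k \<in> component C x"
  proof -
    have "(\<lambda>x y. E x y \<and> x \<notin> C \<and> y \<notin> C)\<^sup>*\<^sup>* k x" using assms unfolding component_def by simp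
    then show ?thesis
    proof (induction rule: rtranclp_induct)
      case base show ?case by (rule component_refl)
    next
      case (step y z)
      then have "y \<in> component C z" using component_step[of z C z y] component_refl E_sym by blast
      then have "component C y \<subseteq> component C z" using component_least[of y "component C z" C] component_step[of z C] step by blast
      then show ?case using step by blast
    qed
  qed
  then have "component C k \<subseteq> component C x" using component_least component_step component_notin[OF assms] by metis
  ultimately show ?thesis by blast
qed

text \<open>\<open>J\<close> is a path mod 2 from \<open>k\<close> through its component to
  \<open>a\<close>; only its odd vertices and its avoiding \<open>C\<close> off \<open>a\<close> are
  needed later.\<close>

lemma att_join:
  assumes k: "k \<notin> C" and a: "a \<in> att C k"
  shows "\<exists>J. J \<subseteq> Es \<and> oddv J = {k, a} \<and> (\<forall>v\<in>C. v \<noteq> a \<longrightarrow> (\<forall>w. {v, w} \<notin> J))"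
proof -
  obtain x where x: "x \<in> component C k" "E x a" and aC: "a \<in> C" using a unfolding att_def by blast
  obtain P where P: "P \<subseteq> {{s, t} |s t. E s t \<and> s \<notin> C \<and> t \<notin> C}" "oddv P = sym_diff {k} {x}"
    using join[of "\<lambda>x y. E x y \<and> x \<notin> C \<and> y \<notin> C" k x] x unfolding component_def by blast
  have xC: "x \<notin> C" using component_notin[OF k x(1)] .
  have "P \<subseteq> Es" using P unfolding Es_def by blast
  then have "oddv (sym_diff P {{x, a}}) = sym_diff (sym_diff {k} {x}) {x, a}"
    using oddv_sym_diff[of P "{{x, a}}"] x P oddv_edge by simp
  also have "\<dots> = {k, a}" using k aC xC by auto
  finally have 1: "oddv (sym_diff P {{x, a}}) = {k, a}" .
  have 2: "sym_diff P {{x, a}} \<subseteq> Es" using \<open>P \<subseteq> Es\<close> x by auto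
  have 3: "{v, w} \<notin> sym_diff P {{x, a}}" if "v \<in> C" "v \<noteq> a" for v w
    using P(1) that xC by (auto simp: doubleton_eq_iff)
  show ?thesis by (rule exI[of _ "sym_diff P {{x, a}}"], intro conjI ballI impI allI 1 2 3)
qed

text \<open>The inner face of \<open>C\<close> passes through \<open>v\<close>, and a curve missing
  \<open>v\<close> encloses no dart there. Being a single face, it is then outside
  altogether.\<close>

lemma ins_cface_untouched:
  assumes C: "cyc C" and Z: "even_edges Z" and v: "v \<in> C" "\<And>w. {v, w} \<notin> Z" and d: "d \<in> cface C"
  shows "\<not> ins Z d"
proof -
  obtain w where w: "(v, w) \<in> cface C" using cface_from[OF C v(1)] by blast
  have "\<not> ins Z (v, w)" using ins_untouched[OF Z _ v(2)] cface_vertices[OF C w] by blast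
  moreover have "F d = F (v, w)" using cface_orbit[OF C] d w by simp
  ultimately show ?thesis using ins_face by blast
qed

text \<open>A path through the component of \<open>k\<close> joining two attachments splits \<open>C\<close> into two cycles. Each of them
  misses a vertex of \<open>C\<close> and so cannot enclose the face \<open>cface C\<close>, although their mod-2 sum does.\<close>

lemma att_adj:
  assumes C: "cyc C" and k: "k \<notin> C" and a: "a \<in> att C k" and b: "b \<in> att C k"
  shows "a = b \<or> E a b"
proof (rule ccontr)
  assume neg: "\<not> (a = b \<or> E a b)"
  have aC: "a \<in> C" "b \<in> C" using a b unfolding att_def by auto
  obtain c where c: "cycmap c C" "c 0 = a" using cycmap_ex[OF C aC(1)] by blast
  let ?n = "card C"
  have n: "3 \<le> ?n" using cyc_card[OF C] .
  have cm: "inj_on c {..<?n}" "c ` {..<?n} = C" "c ?n = c 0"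
    using c unfolding cycmap_def by (blast, blast, metis add_0)
  note Ec = cycmap_edge[OF c(1)]
  obtain j where j: "j < ?n" "c j = b" using aC(2) cm(2) by (metis imageE lessThan_iff)
  \<comment> \<open>Excluding 0, 1 and \<open>?n - 1\<close> leaves \<open>c 1\<close> strictly
    inside the first arc and \<open>c (?n - 1)\<close> strictly inside the second; each serves as
    the vertex missed by the curve along the other arc.\<close>
  have "j \<noteq> 0" using neg j(2) c(2) by metis
  moreover have "j \<noteq> 1" using neg j(2) c(2) Ec[of 0] by (metis One_nat_def)
  ultimately have j1: "j \<noteq> 0" "j \<noteq> 1" .
  have j2: "j \<noteq> ?n - 1"
  proof
    assume "j = ?n - 1"
    then have "E b a" using Ec[of j] j cm c n by simp
    then show False using neg E_sym by blast
  qed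
  obtain J1 where J1: "J1 \<subseteq> Es" "oddv J1 = {k, a}" "\<And>v w. v \<in> C \<Longrightarrow> v \<noteq> a \<Longrightarrow> {v, w} \<notin> J1"
    using att_join[OF k a] by blast
  obtain J2 where J2: "J2 \<subseteq> Es" "oddv J2 = {k, b}" "\<And>v w. v \<in> C \<Longrightarrow> v \<noteq> b \<Longrightarrow> {v, w} \<notin> J2"
    using att_join[OF k b] by blast
  define P where "P = sym_diff J1 J2"
  have kab: "k \<noteq> a" "k \<noteq> b" using k aC by auto
  have P: "P \<subseteq> Es" "oddv P = {a, b}" "\<And>v w. v \<in> C \<Longrightarrow> v \<noteq> a \<Longrightarrow> v \<noteq> b \<Longrightarrow> {v, w} \<notin> P"
    using J1 J2 oddv_sym_diff[of J1 J2] neg kab unfolding P_def by auto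
  define A1 where "A1 = arc c 0 j"
  define A2 where "A2 = arc c j (?n - j)"
  have A: "A1 \<subseteq> Es" "A2 \<subseteq> Es" unfolding A1_def A2_def using arc_sub[of c, OF Ec] by auto
  have oA: "oddv A1 = {a, b}" "oddv A2 = {a, b}"
    unfolding A1_def A2_def using oddv_arc[of c, OF Ec] j c cm neg by auto
  have ev: "even_edges (sym_diff A1 P)" "even_edges (sym_diff A2 P)"
    unfolding even_edges_def using oddv_sym_diff A P oA by auto
  have "sym_diff A1 A2 = cedges C"
    using arc_append[of c 0 j "?n - j"] cycmap_arc[OF C c(1)] j unfolding A1_def A2_def by simp
  then have sum: "cedges C = sym_diff (sym_diff A1 P) (sym_diff A2 P)" by blast
  obtain w where d: "(a, w) \<in> cface C" using cface_from[OF C aC(1)] by blast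
  have "\<not> ins (sym_diff A1 P) (a, w)"
  proof (rule ins_cface_untouched[OF C ev(1) _ _ d])
    show "c (?n - 1) \<in> C" using cm n by auto
    fix w
    have "c (?n - 1) \<noteq> c i" if "i \<le> j" for i
      using inj_onD[OF cm(1), of "?n - 1" i] that j j2 n by force
    then have "{c (?n - 1), w} \<notin> A1" "c (?n - 1) \<noteq> a" "c (?n - 1) \<noteq> b"
      using arc_touch[of "c (?n - 1)" w c 0 j] j(2) c(2) unfolding A1_def by (metis add_0, metis le0, metis le_refl)
    then show "{c (?n - 1), w} \<notin> sym_diff A1 P"
      using P(3)[of "c (?n - 1)" w] cycmap_in[OF c(1)] by simp
  qed
  moreover have "\<not> ins (sym_diff A2 P) (a, w)"
  proof (rule ins_cface_untouched[OF C ev(2) _ _ d])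
    show "c 1 \<in> C" using cm n by auto
    fix w
    have "c 1 \<noteq> c i" if "j \<le> i" "i \<le> ?n" for i
    proof (cases "i = ?n")
      case True
      then show ?thesis using cm n inj_onD[OF cm(1), of 1 0] by auto
    next
      case False
      then show ?thesis using n that j1 inj_onD[OF cm(1), of 1 i] by auto
    qed
    note ne = this
    have "{c 1, w} \<notin> A2"
      using arc_touch[of "c 1" w c j "?n - j"] ne j(1) unfolding A2_def by (metis le_add_diff_inverse less_imp_le_nat)
    moreover have "c 1 \<noteq> a" "c 1 \<noteq> b" using ne[of ?n] ne[of j] j cm(3) c(2) by auto
    ultimately show "{c 1, w} \<notin> sym_diff A2 P"
      using P(3)[of "c 1" w] cycmap_in[OF c(1)] by simp
  qed
  ultimately have "\<not> ins (cedges C) (a, w)" unfolding sum using ins_sym_diff[OF ev] by blast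
  then show False using d unfolding cface_def by simp
qed

text \<open>Paths from \<open>k\<close> to three attachments give three closed curves, each using
  one arc of \<open>C\<close> and missing the attachment opposite to it, hence not enclosing the
  face of \<open>C\<close>. Each path occurs twice and cancels, so the curves add up to
  \<open>C\<close>, which does enclose it. Adjacency of attachments alone would not settle the case
  of a triangle.\<close>

lemma att_three:
  assumes C: "cyc C" and k: "k \<notin> C" and att: "a \<in> att C k" "b \<in> att C k" "d \<in> att C k"
  shows "a = b \<or> b = d \<or> a = d"
proof (rule ccontr)
  assume neg: "\<not> (a = b \<or> b = d \<or> a = d)"
  let ?n = "card C"
  have aC: "a \<in> C" "b \<in> C" "d \<in> C" using att unfolding att_def by auto
  obtain c where c: "cycmap c C" "c 0 = a" using cycmap_ex[OF C aC(1)] by blast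
  have cm: "inj_on c {..<?n}" "c ` {..<?n} = C" "c ?n = c 0"
    using c unfolding cycmap_def by (blast, blast, metis add_0)
  note Ec = cycmap_edge[OF c(1)]
  obtain i0 j0 where ij0: "i0 < ?n" "c i0 = b" "j0 < ?n" "c j0 = d"
    using aC(2,3) cm(2) by (metis imageE lessThan_iff)
  obtain i j where ij: "i < j" "j < ?n" "{c i, c j} = {b, d}"
  proof (cases "i0 < j0")
    case False
    then have "j0 < i0" using ij0 neg by (metis linorder_neqE_nat)
    then show ?thesis using that[of j0 i0] ij0 by auto
  qed (use that ij0 in auto)
  have i0: "0 < i" using ij neg c by (metis doubleton_eq_iff gr_zeroI)
  have at: "c i \<in> att C k" "c j \<in> att C k" "c i \<in> C" "c j \<in> C"
    using ij att aC by (auto simp: doubleton_eq_iff)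
  have dist: "c i \<noteq> c j" "c i \<noteq> a" "c j \<noteq> a" using ij neg by (auto simp: doubleton_eq_iff)
  obtain J0 where J0: "J0 \<subseteq> Es" "oddv J0 = {k, a}" "\<And>v w. v \<in> C \<Longrightarrow> v \<noteq> a \<Longrightarrow> {v, w} \<notin> J0"
    using att_join[OF k att(1)] by blast
  obtain J1 where J1: "J1 \<subseteq> Es" "oddv J1 = {k, c i}" "\<And>v w. v \<in> C \<Longrightarrow> v \<noteq> c i \<Longrightarrow> {v, w} \<notin> J1"
    using att_join[OF k at(1)] by blast
  obtain J2 where J2: "J2 \<subseteq> Es" "oddv J2 = {k, c j}" "\<And>v w. v \<in> C \<Longrightarrow> v \<noteq> c j \<Longrightarrow> {v, w} \<notin> J2"
    using att_join[OF k at(2)] by blast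
  define A0 where "A0 = arc c 0 i"
  define A1 where "A1 = arc c i (j - i)"
  define A2 where "A2 = arc c j (?n - j)"
  have A: "A0 \<subseteq> Es" "A1 \<subseteq> Es" "A2 \<subseteq> Es"
    unfolding A0_def A1_def A2_def using arc_sub[of c, OF Ec] by auto
  have oA: "oddv A0 = {a, c i}" "oddv A1 = {c i, c j}" "oddv A2 = {c j, a}"
    unfolding A0_def A1_def A2_def using oddv_arc[of c, OF Ec] ij c cm dist by auto
  have kne: "k \<noteq> a" "k \<noteq> c i" "k \<noteq> c j" using k aC at by auto
  have three: "even_edges (sym_diff X (sym_diff Y Z))"
    if "X \<subseteq> Es" "Y \<subseteq> Es" "Z \<subseteq> Es" "oddv X = {p, q}" "oddv Y = {k, p}" "oddv Z = {k, q}"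
      "k \<noteq> p" "k \<noteq> q" "p \<noteq> q" for X Y Z p q
  proof -
    have "oddv (sym_diff Y Z) = {p, q}" using oddv_sym_diff[of Y Z] that by auto
    moreover have YZ: "sym_diff Y Z \<subseteq> Es" using that by blast
    ultimately have "oddv (sym_diff X (sym_diff Y Z)) = {}" using oddv_sym_diff[OF that(1) YZ] that(4) by simp
    then show ?thesis using that YZ unfolding even_edges_def by blast
  qed
  note ev = three[OF A(1) J0(1) J1(1) oA(1) J0(2) J1(2) kne(1,2) dist(2)[symmetric]]
    three[OF A(2) J1(1) J2(1) oA(2) J1(2) J2(2) kne(2,3) dist(1)]
    three[OF A(3) J2(1) J0(1) oA(3) J2(2) J0(2) kne(3,1) dist(3)]
  have "sym_diff (sym_diff A0 A1) A2 = cedges C"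
    using arc_append[of c 0 i "j - i"] arc_append[of c 0 j "?n - j"] cycmap_arc[OF C c(1)] ij
    unfolding A0_def A1_def A2_def by simp
  then have sum: "cedges C = sym_diff (sym_diff (sym_diff A0 (sym_diff J0 J1)) (sym_diff A1 (sym_diff J1 J2)))
      (sym_diff A2 (sym_diff J2 J0))" by blast
  obtain w where d: "(a, w) \<in> cface C" using cface_from[OF C aC(1)] by blast
  have ne: "c p \<noteq> c q" if "p < ?n" "q < ?n" "p \<noteq> q" for p q
    using inj_onD[OF cm(1)] that by blast
  have "\<not> ins (sym_diff A0 (sym_diff J0 J1)) (a, w)"
  proof (rule ins_cface_untouched[OF C ev(1) at(4) _ d])
    fix w
    have "{c j, w} \<notin> A0"
    proof
      assume "{c j, w} \<in> A0"
      then obtain q where "q \<le> i" "c j = c q"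
        using arc_touch[of "c j" w c 0 i] unfolding A0_def by (metis add_0)
      then show False using ne[of j q] ij by linarith
    qed
    then show "{c j, w} \<notin> sym_diff A0 (sym_diff J0 J1)"
      using J0(3)[OF at(4), of w] J1(3)[OF at(4), of w] dist by simp
  qed
  moreover have "\<not> ins (sym_diff A1 (sym_diff J1 J2)) (a, w)"
  proof (rule ins_cface_untouched[OF C ev(2) aC(1) _ d])
    fix w
    have "{a, w} \<notin> A1"
    proof
      assume "{a, w} \<in> A1"
      then obtain q where "i \<le> q" "q \<le> i + (j - i)" "a = c q"
        using arc_touch[of a w c i "j - i"] unfolding A1_def by blast
      then show False using ne[of 0 q] ij i0 c(2) by auto
    qed
    then show "{a, w} \<notin> sym_diff A1 (sym_diff J1 J2)"
      using J1(3)[OF aC(1), of w] J2(3)[OF aC(1), of w] dist by simp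
  qed
  moreover have "\<not> ins (sym_diff A2 (sym_diff J2 J0)) (a, w)"
  proof (rule ins_cface_untouched[OF C ev(3) at(3) _ d])
    fix w
    have "c i \<noteq> c q" if "j \<le> q" "q \<le> ?n" for q
      using ne[of i q] ne[of i 0] that ij i0 cm(3) by (cases "q = ?n") auto
    then have "{c i, w} \<notin> A2"
      using arc_touch[of "c i" w c j "?n - j"] ij(2) unfolding A2_def by (metis le_add_diff_inverse less_imp_le_nat)
    then show "{c i, w} \<notin> sym_diff A2 (sym_diff J2 J0)"
      using J2(3)[OF at(3), of w] J0(3)[OF at(3), of w] dist by simp
  qed
  ultimately have "\<not> ins (cedges C) (a, w)"
    unfolding sum using ins_sym_diff[OF even_sym_diff[OF ev(1,2)] ev(3)] ins_sym_diff[OF ev(1,2)] by blast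
  then show False using d unfolding cface_def by simp
qed

text \<open>No vertex is a dead end in an even edge set, so a walk that never turns straight back
  can be continued forever and has to repeat a vertex.\<close>

lemma even_edges_contains_cycle:
  assumes Z: "even_edges Z" and ne: "Z \<noteq> {}"
  shows "\<exists>p n. 3 \<le> n \<and> inj_on p {..<n} \<and> p n = p 0 \<and> (\<forall>k. {p k, p (Suc k)} \<in> Z)"
proof -
  have ZEs: "Z \<subseteq> Es" using Z unfolding even_edges_def by simp
  have cont: "\<exists>z. z \<noteq> x \<and> {y, z} \<in> Z" if xy: "{x, y} \<in> Z" for x y
  proof (rule ccontr)
    assume "\<not> (\<exists>z. z \<noteq> x \<and> {y, z} \<in> Z)"
    then have "{w. {y, w} \<in> Z} = {x}" using xy by (auto simp: insert_commute)
    moreover have "y \<in> V" using xy ZEs E_V by (metis Es_iff subsetD)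
    ultimately have "y \<in> oddv Z" unfolding oddv_def by simp
    then show False using Z unfolding even_edges_def by simp
  qed
  obtain u0 v0 where uv: "{u0, v0} \<in> Z" using ne ZEs Es_cases by (metis ex_in_conv subsetD)
  define g where "g d = (snd d, SOME z. z \<noteq> fst d \<and> {snd d, z} \<in> Z)" for d :: "'a \<times> 'a"
  define w where "w k = fst ((g ^^ k) (u0, v0))" for k
  have wk: "(g ^^ k) (u0, v0) = (w k, w (Suc k))" for k
    unfolding w_def by (simp add: g_def prod_eq_iff)
  have wn: "w (Suc (Suc k)) = (SOME z. z \<noteq> w k \<and> {w (Suc k), z} \<in> Z)" for k
  proof -
    have "(w (Suc k), w (Suc (Suc k))) = g (w k, w (Suc k))" using wk[of k] wk[of "Suc k"] by simp
    then show ?thesis unfolding g_def by simp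
  qed
  have step: "w (Suc (Suc k)) \<noteq> w k \<and> {w (Suc k), w (Suc (Suc k))} \<in> Z" if "{w k, w (Suc k)} \<in> Z" for k
    unfolding wn[of k] by (rule someI_ex[OF cont[OF that]])
  have edge: "{w k, w (Suc k)} \<in> Z" for k
  proof (induction k)
    case 0
    show ?case using uv wk[of 0] by auto
  qed (use step in blast)
  have gk: "{w k, w (Suc k)} \<in> Z \<and> w (Suc (Suc k)) \<noteq> w k" for k
    using edge step by blast
  have wE: "E (w k) (w (Suc k))" for k using gk[of k] ZEs by (metis Es_iff subsetD)
  have "range w \<subseteq> V" using wE E_V(1) by blast
  then have "\<not> inj w" using finV by (meson finite_subset infinite_UNIV_nat finite_imageD)
  then obtain i j where "i \<noteq> j" "w i = w j" unfolding inj_def by blast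
  then have "\<exists>m>0. \<exists>i. w i = w (i + m)"
    by (metis linorder_neqE_nat less_imp_add_positive)
  \<comment> \<open>Minimising the return time over all starting points makes the resulting closed
    walk injective. The values 1 and 2 are impossible: there are no loops and no immediate
    reversals.\<close>
  then obtain n where n: "0 < n" "\<exists>i. w i = w (i + n)"
    and min: "\<And>m. 0 < m \<Longrightarrow> m < n \<Longrightarrow> \<not> (\<exists>i. w i = w (i + m))"
    using exists_least_iff[of "\<lambda>m. m > 0 \<and> (\<exists>i. w i = w (i + m))"] by blast
  then obtain i where i: "w i = w (i + n)" by blast
  define p where "p k = w (i + k)" for k
  have "n \<noteq> 1" using i wE[of i] E_irr by (metis One_nat_def add.right_neutral add_Suc_right)
  moreover have "n \<noteq> 2" using i gk[of i] by (metis add_2_eq_Suc')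
  ultimately have "3 \<le> n" using n by linarith
  moreover have "inj_on p {..<n}"
  proof (rule linorder_inj_onI')
    fix s t assume st: "s \<in> {..<n}" "t \<in> {..<n}" "s < t"
    show "p s \<noteq> p t"
    proof
      assume "p s = p t"
      then have "w (i + s) = w (i + s + (t - s))" using st unfolding p_def by simp
      moreover have "0 < t - s" "t - s < n" using st by auto
      ultimately show False using min[of "t - s"] by blast
    qed
  qed
  moreover have "p n = p 0" using i unfolding p_def by simp
  moreover have "\<forall>k. {p k, p (Suc k)} \<in> Z" using gk unfolding p_def by simp
  ultimately show ?thesis by blast
qed

text \<open>A smallest even edge set enclosing the face \<open>f\<close> is a chordless cycle: splitting off a
  subcycle, or splitting along a chord, leaves a smaller one that still encloses \<open>f\<close>.\<close>

lemma internal_face_cyc: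
  assumes f: "f \<in> internal_faces V E \<sigma> Of"
  shows "\<exists>C. cyc C \<and> cface C = f"
proof -
  obtain d where d: "d \<in> D" "f = F d" "F d \<noteq> Of" "F d \<in> faces V E \<sigma>"
    using f unfolding internal_faces_def faces_def by blast
  let ?P = "\<lambda>Z. even_edges Z \<and> ins Z d"
  have "?P (bd {F d})" using bd_even ins_bd[of "{F d}" d] d by auto
  from ex_has_least_nat[of ?P, OF this, of card]
  obtain Z where Z: "even_edges Z" "ins Z d" and min: "\<And>Y. even_edges Y \<Longrightarrow> ins Y d \<Longrightarrow> card Z \<le> card Y"
    by blast
  have ZEs: "Z \<subseteq> Es" using Z unfolding even_edges_def by simp
  then have finZ: "finite Z" using finEs finite_subset by blast
  have "Z \<noteq> {}" using Z bd_empty unfolding ins_def by blast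
  then obtain p n where n: "3 \<le> n" and inj: "inj_on p {..<n}" and pn: "p n = p 0"
    and pZ: "\<And>k. {p k, p (Suc k)} \<in> Z"
    using even_edges_contains_cycle[OF Z(1)] by blast
  have pE: "E (p k) (p (Suc k))" for k using pZ ZEs by (metis Es_iff subsetD)
  define Y where "Y = arc p 0 n"
  have Y: "Y = (\<lambda>k. {p k, p (Suc k)}) ` {..<n}" unfolding Y_def by (rule closed_arc(2)[OF n inj pn])
  have cardY: "card Y = n" unfolding Y using card_image[OF closed_arc(1)[OF n inj pn]] by simp
  have YZ: "Y \<subseteq> Z" unfolding Y using pZ by blast
  have Yev: "even_edges Y"
    unfolding even_edges_def Y_def using arc_sub[of p, OF pE] oddv_arc[of p 0 n, OF pE] pn by simp
  have Yins: "ins Y d"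
  proof (rule ccontr)
    assume "\<not> ins Y d"
    then have "ins (sym_diff Z Y) d" using ins_sym_diff[OF Z(1) Yev] Z by blast
    then have "card Z \<le> card (sym_diff Z Y)" using min even_sym_diff[OF Z(1) Yev] by blast
    moreover have "sym_diff Z Y = Z - Y" using YZ by blast
    moreover have "card (Z - Y) < card Z"
    proof (rule psubset_card_mono[OF finZ])
      have "Y \<noteq> {}" using cardY n by auto
      then show "Z - Y \<subset> Z" using YZ by blast
    qed
    ultimately show False by simp
  qed
  have small: "n \<le> card X" if "even_edges X" "ins X d" for X
    using min[OF that] card_mono[OF finZ YZ] cardY by simp
  have chord: "t = Suc s \<or> (s = 0 \<and> t = n - 1)" if st: "s < t" "t < n" "E (p s) (p t)" for s t
  proof (rule ccontr)
    assume no: "\<not> (t = Suc s \<or> (s = 0 \<and> t = n - 1))"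
    define e where "e = {p s, p t}"
    define A where "A = arc p s (t - s)"
    define B1 where "B1 = arc p 0 s"
    define B2 where "B2 = arc p t (n - t)"
    define Y1 where "Y1 = sym_diff A {e}"
    define Y2 where "Y2 = sym_diff (sym_diff B1 B2) {e}"
    have "sym_diff (sym_diff B1 A) B2 = Y"
      unfolding B1_def A_def B2_def Y_def
      using arc_append[of p 0 s "t - s"] arc_append[of p 0 t "n - t"] st by simp
    then have Y2: "Y2 = sym_diff Y Y1" unfolding Y2_def Y1_def by blast
    have "p s \<noteq> p t" using st(3) E_irr by metis
    moreover have "oddv A = sym_diff {p s} {p t}"
      using oddv_arc[of p s "t - s", OF pE] st(1) unfolding A_def by simp
    ultimately have "oddv A = {p s, p t}" by auto
    then have "oddv Y1 = {}"
      unfolding Y1_def e_def using oddv_sym_diff[of A "{{p s, p t}}"] oddv_edge[OF st(3)]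
        arc_sub[of p, OF pE] st(3) unfolding A_def by simp
    moreover have "Y1 \<subseteq> Es" unfolding Y1_def A_def e_def using arc_sub[of p, OF pE] st(3) by auto
    ultimately have Y1ev: "even_edges Y1" unfolding even_edges_def by blast
    have "ins Y1 d \<or> ins Y2 d" using ins_sym_diff[OF Yev Y1ev] Yins unfolding Y2 by blast
    then have "n \<le> card Y1 \<or> n \<le> card Y2" using small Y1ev even_sym_diff[OF Yev Y1ev] Y2 by blast
    moreover have "card Y1 \<le> (t - s) + 1"
    proof -
      have "card Y1 \<le> card (A \<union> {e})"
        using card_arc unfolding Y1_def A_def by (intro card_mono) auto
      also have "\<dots> \<le> (t - s) + 1"
        using card_Un_le[of A "{e}"] card_arc[of p s "t - s"] unfolding A_def by simp
      finally show ?thesis .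
    qed
    moreover have "card Y2 \<le> s + (n - t) + 1"
    proof -
      have "card Y2 \<le> card (B1 \<union> B2 \<union> {e})"
        using card_arc unfolding Y2_def B1_def B2_def by (intro card_mono) auto
      also have "\<dots> \<le> s + (n - t) + 1"
        using card_Un_le[of "B1 \<union> B2" "{e}"] card_Un_le[of B1 B2] card_arc[of p 0 s] card_arc[of p t "n - t"]
        unfolding B1_def B2_def by simp
      finally show ?thesis .
    qed
    \<comment> \<open>Both bounds are below \<open>n\<close> because \<open>p s\<close> and
      \<open>p t\<close> are not consecutive on the cycle.\<close>
    ultimately show False using st no by linarith
  qed
  let ?C = "p ` {..<n}"
  note cw = chordless_closed_walk[OF n inj pn pE chord]
  have "d \<in> cface ?C" using Yins d cw(2) unfolding cface_def Y by simp
  then show ?thesis using cface_orbit[OF cw(1)] cw(1) d by blast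
qed

text \<open>\<open>cface\<close> matches induced cycles with internal faces and preserves length;
  the cycle is recovered as the set of starting points of the darts.\<close>

lemma faces_condition_iff:
  "card {f \<in> internal_faces V E \<sigma> Of. card f \<in> {5, 6}} \<le> 1
    \<and> \<not> (\<exists>f\<in>internal_faces V E \<sigma> Of. card f > 6)
   \<longleftrightarrow> (\<forall>C. cyc C \<longrightarrow> card C \<le> 6) \<and> (\<forall>C C'. cyc C \<longrightarrow> cyc C' \<longrightarrow> 5 \<le> card C \<longrightarrow> 5 \<le> card C' \<longrightarrow> C = C')"
  (is "card ?A \<le> 1 \<and> ?N \<longleftrightarrow> ?B \<and> ?U")
proof -
  have N: "?N \<longleftrightarrow> ?B"
    using cface_internal card_cface internal_face_cyc by (metis linorder_not_less)
  have fin: "finite ?A" using fin_faces unfolding internal_faces_def by simp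
  then have one: "card ?A \<le> 1 \<longleftrightarrow> (\<forall>f\<in>?A. \<forall>g\<in>?A. f = g)"
    using card_le_Suc0_iff_eq[OF fin] by simp
  have key: "(\<forall>f\<in>?A. \<forall>g\<in>?A. f = g) \<longleftrightarrow> ?U" if B: ?B
  proof
    assume L: "\<forall>f\<in>?A. \<forall>g\<in>?A. f = g"
    show ?U
    proof (intro allI impI)
      fix C C' assume C: "cyc C" "cyc C'" "5 \<le> card C" "5 \<le> card C'"
      have "card X = 5 \<or> card X = 6" if "cyc X" "5 \<le> card X" for X
      proof -
        have "card X \<le> 6" using B that by blast
        then show ?thesis using that by arith
      qed
      then have "cface C \<in> ?A" "cface C' \<in> ?A"
        using C cface_internal card_cface by auto
      then have "cface C = cface C'" using L by blast
      then show "C = C'" using C cface_fst by metis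
    qed
  next
    assume U: ?U
    show "\<forall>f\<in>?A. \<forall>g\<in>?A. f = g"
    proof (intro ballI)
      fix f g assume fg: "f \<in> ?A" "g \<in> ?A"
      then obtain C C' where C: "cyc C" "cface C = f" "cyc C'" "cface C' = g"
        using internal_face_cyc by blast
      moreover have "5 \<le> card C" "5 \<le> card C'" using C card_cface fg by force+
      ultimately show "f = g" using U by blast
    qed
  qed
  have "(a \<and> N) = (B \<and> U)" if "N = B" "a = L" "B \<Longrightarrow> L = U" for a N B L U :: bool
    using that by auto
  from this[OF N one key] show ?thesis .
qed

end

section \<open>The game\<close>

lemma rel_mset_pair: "R u u' \<Longrightarrow> R v v' \<Longrightarrow> rel_mset R {#u, v#} {#u', v'#}"
  by (intro rel_mset_Plus rel_mset_Zero)

lemma rel_mset_in: "rel_mset R M N \<Longrightarrow> y \<in># N \<Longrightarrow> \<exists>x\<in>#M. R x y"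
  unfolding rel_mset_def by (metis in_set_conv_nth list_all2_conv_all_nth set_mset_mset)

lemma rel_mset_size: "rel_mset R M N \<Longrightarrow> size N = size M"
  unfolding rel_mset_def by (metis list_all2_lengthD size_mset)

lemma capture_one: "cmove E u r \<Longrightarrow> cop_win E {#u#} r"
  by (rule cop_win.capture[of E _ "{#r#}"]) (auto intro: rel_mset_Plus rel_mset_Zero)

lemma capture_pair:
  assumes "cmove E u r \<or> cmove E v r"
  shows "cop_win E {#u, v#} r"
  using assms
proof
  assume "cmove E u r"
  then show ?thesis
    by (intro cop_win.capture[of E _ "{#r, v#}"] rel_mset_pair) (auto simp: cmove_def)
next
  assume "cmove E v r"
  then show ?thesis
    by (intro cop_win.capture[of E _ "{#u, r#}"] rel_mset_pair) (auto simp: cmove_def)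
qed

text \<open>Winning positions of the cops violate the invariant of the robber: no immediate capture,
  and two cops are faced only from within \<open>S\<close>. If no cop stands beside the robber,
  passing preserves it. A neighbouring cop that is not protected is attacked, and no remaining cop
  can strike back. Only a protected neighbouring cop calls for \<open>escape\<close>.\<close>

lemma robber_evades:
  assumes sym: "\<And>x y. E x y \<Longrightarrow> E y x"
    and escape: "\<And>r c c'. r \<in> S \<Longrightarrow> c \<noteq> r \<Longrightarrow> c' \<noteq> r \<Longrightarrow> E c r \<Longrightarrow> cmove E c' c \<Longrightarrow>
      \<exists>b\<in>S. E r b \<and> \<not> cmove E c b \<and> \<not> cmove E c' b"
    and win: "cop_win E M r"
  shows "\<not> ((\<forall>c\<in>#M. \<not> cmove E c r) \<and> (size M \<le> 1 \<or> size M = 2 \<and> r \<in> S))"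
  using win
proof induction
  case (capture M M' r)
  then show ?case using rel_mset_in by metis
next
  case (step M M' r)
  show ?case
  proof
    assume safe: "(\<forall>c\<in>#M. \<not> cmove E c r) \<and> (size M \<le> 1 \<or> size M = 2 \<and> r \<in> S)"
    have size: "size M' = size M" using rel_mset_size step(1) by blast
    have no: "\<not> ((\<forall>c\<in>#(if r' \<in># M' then M' - {#r'#} else M'). \<not> cmove E c r') \<and>
        (size (if r' \<in># M' then M' - {#r'#} else M') \<le> 1
          \<or> size (if r' \<in># M' then M' - {#r'#} else M') = 2 \<and> r' \<in> S))"
      if "cmove E r r'" for r'
      using step(3) that by blast
    show False
    proof (cases "\<exists>c\<in>#M'. E c r")
      case False
      then have "\<forall>c\<in>#M'. \<not> cmove E c r" using step(2) unfolding cmove_def by auto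
      then show False using no[of r] step(2) safe size unfolding cmove_def by auto
    next
      case True
      then obtain c where c: "c \<in># M'" "E c r" by blast
      then obtain M1 where M1: "M' = add_mset c M1" by (meson multi_member_split)
      show False
      proof (cases "\<exists>c'\<in>#M1. cmove E c' c")
        case False
        then show False using no[of c] c M1 safe size sym unfolding cmove_def by auto
      next
        case True
        then obtain c' where c': "c' \<in># M1" "cmove E c' c" by blast
        then obtain M2 where M2: "M1 = add_mset c' M2" by (meson multi_member_split)
        then have two: "M' = {#c, c'#}" "r \<in> S" using safe size M1 by auto
        obtain b where b: "b \<in> S" "E r b" "\<not> cmove E c b" "\<not> cmove E c' b"
          using escape[of r c c'] two c c' step(2) by auto
        then have "b \<notin># M'" using two unfolding cmove_def by auto
        then show False using no[of b] b two unfolding cmove_def by auto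
      qed
    qed
  qed
qed

lemma card_le_2I:
  assumes "finite A" "\<And>a b c. a \<in> A \<Longrightarrow> b \<in> A \<Longrightarrow> c \<in> A \<Longrightarrow> a = b \<or> b = c \<or> a = c"
  shows "card A \<le> 2"
proof (rule ccontr)
  assume "\<not> card A \<le> 2"
  then have "3 \<le> card A" by simp
  then obtain B where "B \<subseteq> A" "card B = 3" by (meson obtain_subset_with_card_n)
  then obtain a b c where "B = {a, b, c}" "a \<noteq> b" "b \<noteq> c" "a \<noteq> c"
    by (auto simp: card_3_iff)
  then show False using assms(2)[of a b c] \<open>B \<subseteq> A\<close> by auto
qed

context outerplane
begin

text \<open>Cops on equal or adjacent vertices protect each other: an attacker is captured at once.\<close>

lemma advance:
  assumes mv: "cmove E u u' \<and> cmove E v v' \<or> cmove E u v' \<and> cmove E v u'"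
    and adj: "u' = v' \<or> E u' v'" and r: "r \<noteq> u'" "r \<noteq> v'"
    and win: "\<And>r'. cmove E r r' \<Longrightarrow> r' \<noteq> u' \<Longrightarrow> r' \<noteq> v' \<Longrightarrow> cop_win E {#u', v'#} r'"
  shows "cop_win E {#u, v#} r"
proof (rule cop_win.step[of E _ "{#u', v'#}"])
  show "rel_mset (cmove E) {#u, v#} {#u', v'#}"
    using mv rel_mset_pair[of "cmove E" u u' v v'] rel_mset_pair[of "cmove E" u v' v u']
    by (auto simp: add_mset_commute)
  show "r \<notin># {#u', v'#}" using r by auto
  show "\<forall>r'. cmove E r r' \<longrightarrow>
      cop_win E (if r' \<in># {#u', v'#} then {#u', v'#} - {#r'#} else {#u', v'#}) r'"
  proof (intro allI impI)
    fix r' assume r': "cmove E r r'"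
    consider "r' = u'" | "r' = v'" "r' \<noteq> u'" | "r' \<noteq> u'" "r' \<noteq> v'" by blast
    then show "cop_win E (if r' \<in># {#u', v'#} then {#u', v'#} - {#r'#} else {#u', v'#}) r'"
    proof cases
      case 1
      have "cmove E v' u'" using adj E_sym unfolding cmove_def by auto
      then show ?thesis using capture_one 1 by simp
    next
      case 2
      have "cmove E u' v'" using adj unfolding cmove_def by auto
      then show ?thesis using capture_one 2 by simp
    next
      case 3
      then show ?thesis using win r' by simp
    qed
  qed
qed

section \<open>Cops: shrinking the region of the robber\<close>

lemma exit_edge:
  assumes "E\<^sup>*\<^sup>* a b" "a \<in> K" "b \<notin> K"
  shows "\<exists>x\<in>K. \<exists>y. y \<notin> K \<and> E x y"
  using assms by (induction rule: rtranclp_induct) auto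

text \<open>Cops on the edge \<open>z t\<close> seal off the component of \<open>k\<close>. If
  \<open>z\<close> is the only attachment, \<open>t\<close> may be any neighbour of \<open>z\<close>
  on \<open>C\<close>.\<close>

lemma att_pair:
  assumes C: "cyc C" and k: "k \<notin> C" and z: "z \<in> att C k"
  shows "\<exists>t\<in>C. E z t \<and> att C k \<subseteq> {z, t}"
proof (cases "att C k \<subseteq> {z}")
  case True
  have "z \<in> C" using z unfolding att_def by simp
  then obtain p q where "{w\<in>C. E z w} = {p, q}" using cyc_nbrs[OF C] by blast
  then have "p \<in> C \<and> E z p" by blast
  then show ?thesis using True by blast
next
  case False
  then obtain t where t: "t \<in> att C k" "t \<noteq> z" by blast
  have "att C k \<subseteq> {z, t}" using att_three[OF C k z t(1)] t(2) by blast
  moreover have "E z t" using att_adj[OF C k z t(1)] t(2) by blast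
  moreover have "t \<in> C" using t unfolding att_def by simp
  ultimately show ?thesis by blast
qed

lemma component_att_step: "k \<notin> C \<Longrightarrow> x \<in> component C k \<Longrightarrow> E x y \<Longrightarrow> y \<in> component C k \<or> y \<in> att C k"
  using component_step unfolding att_def by blast

text \<open>A shortest path from \<open>u\<close> to \<open>v\<close> through the component has no
  chord except \<open>u v\<close> itself, which closes it to an induced cycle.\<close>

lemma shortest_cycle:
  assumes uv: "E u v" and r: "r \<noteq> u" "r \<noteq> v"
    and a: "a \<in> component {u, v} r" "E a u" and b: "b \<in> component {u, v} r" "E b v"
  shows "\<exists>f n. 2 \<le> n \<and> f 0 = u \<and> f n = v \<and> (\<forall>i. 0 < i \<longrightarrow> i < n \<longrightarrow> f i \<in> component {u, v} r)
     \<and> (\<forall>i<n. E (f i) (f (Suc i))) \<and> cyc (f ` {..n}) \<and> card (f ` {..n}) = Suc n"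
proof -
  let ?K = "component {u, v} r"
  have rn: "r \<notin> {u, v}" using r by simp
  have uvK: "u \<notin> ?K" "v \<notin> ?K" using component_notin[OF rn] by blast+
  have une: "u \<noteq> v" using uv E_irr by metis
  \<comment> \<open>Excluding the edge from \<open>u\<close> to \<open>v\<close>, and any return to
    \<open>u\<close> or departure from \<open>v\<close>, forces the walk through the
    component.\<close>
  define Q where "Q = (\<lambda>x y. E x y \<and> x \<in> insert u ?K \<and> y \<in> insert v ?K \<and> \<not> (x = u \<and> y = v))"
  have ab: "Q\<^sup>*\<^sup>* a b"
  proof -
    have "b \<in> component {u, v} a" using component_sym[OF rn a(1)] b by simp
    then have "(\<lambda>x y. E x y \<and> x \<notin> {u, v} \<and> y \<notin> {u, v})\<^sup>*\<^sup>* a b" unfolding component_def by simp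
    then have "Q\<^sup>*\<^sup>* a b \<and> b \<in> ?K"
    proof (induction rule: rtranclp_induct)
      case (step y z)
      then have "z \<in> ?K" using component_step[OF rn] by blast
      moreover from this have "Q y z" using step uvK unfolding Q_def by blast
      ultimately show ?case using step rtranclp.rtrancl_into_rtrancl[of Q] by metis
    qed (use a in simp)
    then show ?thesis by blast
  qed
  have "Q u a" "Q b v" using a b E_sym uvK unfolding Q_def by auto
  then have "Q\<^sup>*\<^sup>* u v"
    using ab by (meson converse_rtranclp_into_rtranclp rtranclp.rtrancl_into_rtrancl)
  then have "\<exists>n. (Q ^^ n) u v" by (simp add: rtranclp_power)
  then obtain n where n: "(Q ^^ n) u v" and min: "\<And>m. m < n \<Longrightarrow> \<not> (Q ^^ m) u v"
    using exists_least_iff[of "\<lambda>n. (Q ^^ n) u v"] by blast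
  obtain f where f: "f 0 = u" "f n = v" "\<And>i. i < n \<Longrightarrow> Q (f i) (f (Suc i))"
    using n unfolding relpowp_fun_conv by blast
  have pre: "(Q ^^ i) u (f i)" if "i \<le> n" for i
    unfolding relpowp_fun_conv using f that by (intro exI[of _ f]) auto
  have suf: "(Q ^^ (n - i)) (f i) v" if "i \<le> n" for i
    unfolding relpowp_fun_conv using f that by (intro exI[of _ "\<lambda>k. f (i + k)"]) auto
  have nochord: "\<not> Q (f i) (f j)" if "Suc i < j" "j \<le> n" for i j
  proof
    assume "Q (f i) (f j)"
    then have "(Q ^^ Suc i) u (f j)" using pre[of i] that by auto
    then have "(Q ^^ (Suc i + (n - j))) u v" using suf[of j] that relpowp_trans by metis
    moreover have "Suc i + (n - j) < n" using that by linarith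
    ultimately show False using min by blast
  qed
  have dist: "f i \<noteq> f j" if "i < j" "j \<le> n" for i j
  proof
    assume "f i = f j"
    then have "(Q ^^ (i + (n - j))) u v" using suf[of j] pre[of i] that relpowp_trans[of i Q u "f i" "n - j" v] by simp
    moreover have "i + (n - j) < n" using that by linarith
    ultimately show False using min by blast
  qed
  have n0: "n \<noteq> 0" using f une by (cases n) auto
  moreover have "n \<noteq> 1" using f une unfolding Q_def by (metis One_nat_def lessI)
  ultimately have n2: "2 \<le> n" by linarith
  have inK: "f i \<in> ?K" if "0 < i" "i < n" for i
  proof -
    have "f i \<in> insert u ?K" using f(3)[of i] that unfolding Q_def by blast
    moreover have "f i \<noteq> u" using dist[of 0 i] that f(1) by simp
    ultimately show ?thesis by blast
  qed
  have Ef: "E (f i) (f (Suc i))" if "i < n" for i using f(3)[OF that] unfolding Q_def by blast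
  \<comment> \<open>The value \<open>u\<close> at \<open>Suc n\<close> closes the walk.\<close>
  define p where "p k = (if k \<le> n then f k else u)" for k
  have img: "p ` {..<Suc n} = f ` {..n}" unfolding p_def by (auto simp: less_Suc_eq_le)
  have cw: "cyc (p ` {..<Suc n})" "card (p ` {..<Suc n}) = Suc n"
  proof (rule chordless_closed_walk(1), goal_cases)
    case 6
    show ?case
    proof -
      have "inj_on p {..<Suc n}"
        by (rule linorder_inj_onI') (use dist in \<open>auto simp: p_def\<close>)
      then show ?thesis using card_image by fastforce
    qed
  next
    case 2
    show ?case by (rule linorder_inj_onI') (use dist in \<open>auto simp: p_def\<close>)
  next
    case (4 k)
    show ?case
    proof (cases "k = n")
      case True
      then show ?thesis using E_sym[OF uv] f unfolding p_def by simp
    next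
      case False
      then show ?thesis using 4 Ef unfolding p_def by simp
    qed
  next
    case (5 s t)
    then have st: "s < t" "t \<le> n" "E (f s) (f t)" unfolding p_def by auto
    show ?case
    proof (rule ccontr)
      assume no: "\<not> (t = Suc s \<or> (s = 0 \<and> t = Suc n - 1))"
      then have "Suc s < t" using st by simp
      moreover have "Q (f s) (f t)"
      proof -
        have "f s \<in> insert u ?K" using inK[of s] f(1) st by (cases "s = 0") auto
        moreover have "f t \<in> insert v ?K" using inK[of t] f(2) st by (cases "t = n") auto
        moreover have "\<not> (f s = u \<and> f t = v)"
        proof
          assume h: "f s = u \<and> f t = v"
          have "s = 0" using dist[of 0 s] h f(1) st by fastforce
          moreover have "t = n" using dist[of t n] h f(2) st by fastforce
          ultimately show False using no by simp
        qed
        ultimately show ?thesis using st unfolding Q_def by blast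
      qed
      ultimately show False using nochord[of s t] st by blast
    qed
  qed (use n2 f in \<open>auto simp: p_def\<close>)
  show ?thesis
    using n2 f inK Ef cw unfolding img by (intro exI[of _ f] exI[of _ n]) blast
qed

text \<open>The robber can leave \<open>K\<close> only over guarded vertices. The weight 2 in the
  measure balances the flag for distinct guards: spreading from one vertex to an edge is paid for by
  a vertex of \<open>K\<close>, and gathering on one vertex counts as progress by itself. Cycles are
  bounded only inside the region, because a long cycle may lie elsewhere.\<close>

lemma region_win:
  assumes "K \<subseteq> V" "u \<in> V" "v \<in> V" "r \<in> K" "u \<notin> K" "v \<notin> K" "u = v \<or> E u v"
    "\<And>x y. x \<in> K \<Longrightarrow> E x y \<Longrightarrow> y \<in> K \<or> y = u \<or> y = v"
    "\<And>C. cyc C \<Longrightarrow> C \<subseteq> K \<union> {u, v} \<Longrightarrow> card C \<le> 4"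
  shows "cop_win E {#u, v#} r"
  using assms
proof (induction "2 * card K + (if u = v then 0 else 1)" arbitrary: K u v r rule: less_induct)
  case less
  note KV = less.prems(1) and uV = less.prems(2,3) and rK = less.prems(4) and uK = less.prems(5,6)
    and adj = less.prems(7) and closed = less.prems(8) and small = less.prems(9)
  have finK: "finite K" using KV finV finite_subset by blast
  show ?case
  proof (cases "cmove E u r \<or> cmove E v r")
    case True
    then show ?thesis by (rule capture_pair)
  next
    case False
    then have rne: "r \<noteq> u" "r \<noteq> v" "\<not> E u r" "\<not> E v r" unfolding cmove_def by auto
    have rn: "r \<notin> {u, v}" using rne by simp
    define K0 where "K0 = component {u, v} r"
    have rK0: "r \<in> K0" unfolding K0_def by (rule component_refl)
    have K0K: "K0 \<subseteq> K" unfolding K0_def using component_least[of r K "{u, v}"] rK closed by blast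
    have cK0: "card K0 \<le> card K" using card_mono[OF finK K0K] .
    have K0c: "y \<in> K0 \<or> y = u \<or> y = v" if "x \<in> K0" "E x y" for x y
      using component_step[OF rn, of x y] that unfolding K0_def by blast
    have smaller: "card C \<le> 4" if "cyc C" "C \<subseteq> K' \<union> {u', v'}" "K' \<subseteq> K" "u' \<in> K \<union> {u, v}" "v' \<in> K \<union> {u, v}" for C K' u' v'
      using small[OF that(1)] that by blast
    show ?thesis
    proof (cases "u = v")
      case True
      \<comment> \<open>An edge leaving \<open>K0\<close> can only end in \<open>u\<close>, so
        \<open>x\<close> is a neighbour of \<open>u\<close>; one cop takes it while the other
        stays.\<close>
      obtain x y where xy: "x \<in> K0" "y \<notin> K0" "E x y"
        using exit_edge[OF reach[of r u], of K0] rK KV uV rK0 K0K uK by blast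
      then have ux: "E u x" using K0c[OF xy(1,3)] True E_sym by blast
      have xr: "r \<noteq> x" using ux rne by blast
      have xK: "x \<in> K" using xy K0K by blast
      show ?thesis
      proof (rule advance[of u u v x])
        show "cmove E u u \<and> cmove E v x \<or> cmove E u x \<and> cmove E v u"
          using True ux unfolding cmove_def by blast
        show "u = x \<or> E u x" using ux by blast
        show "r \<noteq> u" "r \<noteq> x" using rne xr by auto
        fix r' assume r': "cmove E r r'" "r' \<noteq> u" "r' \<noteq> x"
        then have r'K: "r' \<in> K0" using K0c[OF rK0] rK0 True unfolding cmove_def by blast
        show "cop_win E {#u, x#} r'"
        proof (rule less.hyps[of "K0 - {x}"])
          have "card (K0 - {x}) < card K"
            using cK0 xy(1) finite_subset[OF K0K finK] by (metis card_Diff1_less less_le_trans)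
          then show "2 * card (K0 - {x}) + (if u = x then 0 else 1) < 2 * card K + (if u = v then 0 else 1)"
            by auto
          show "K0 - {x} \<subseteq> V" using K0K KV by blast
          show "u \<in> V" "x \<in> V" using uV xK KV by auto
          show "r' \<in> K0 - {x}" using r'K r' by blast
          show "u \<notin> K0 - {x}" "x \<notin> K0 - {x}" using uK K0K by auto
          show "u = x \<or> E u x" using ux by blast
          show "z \<in> K0 - {x} \<or> z = u \<or> z = x" if "y \<in> K0 - {x}" "E y z" for y z
            using K0c[of y z] that True by blast
          show "card C \<le> 4" if "cyc C" "C \<subseteq> K0 - {x} \<union> {u, x}" for C
            by (rule smaller[OF that]) (use K0K xK in auto)
        qed
      qed
    next
      case False
      then have Euv: "E u v" using adj by blast
      have one: "cop_win E {#u, v#} r"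
        if s: "s = u \<and> t = v \<or> s = v \<and> t = u" and nt: "\<not> (\<exists>x\<in>K0. E x t)" for s t
      proof (rule advance[of u s v s])
        show "cmove E u s \<and> cmove E v s \<or> cmove E u s \<and> cmove E v s"
          using s Euv E_sym unfolding cmove_def by blast
        show "r \<noteq> s" "r \<noteq> s" using rne s by auto
        have K0s: "y \<in> K0 \<or> y = s" if "x \<in> K0" "E x y" for x y
          using K0c[OF that] nt that s by blast
        fix r' assume r': "cmove E r r'" "r' \<noteq> s"
        then have r'K: "r' \<in> K0" using K0s[OF rK0] rK0 unfolding cmove_def by blast
        show "cop_win E {#s, s#} r'"
        proof (rule less.hyps[of K0])
          show "2 * card K0 + (if s = s then 0 else 1) < 2 * card K + (if u = v then 0 else 1)"
            using cK0 False by simp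
          show "K0 \<subseteq> V" using K0K KV by blast
          show "s \<in> V" "s \<in> V" using uV s by auto
          show "s \<notin> K0" "s \<notin> K0" using uK K0K s by auto
          show "z \<in> K0 \<or> z = s \<or> z = s" if "y \<in> K0" "E y z" for y z
            using K0s[OF that] by blast
          show "card C \<le> 4" if "cyc C" "C \<subseteq> K0 \<union> {s, s}" for C
            by (rule smaller[OF that]) (use K0K s in auto)
          show "s = s \<or> E s s" by blast
          show "r' \<in> K0" by (rule r'K)
        qed
      qed blast
      show ?thesis
      proof (cases "(\<exists>x\<in>K0. E x u) \<and> (\<exists>x\<in>K0. E x v)")
        case False
        then show ?thesis using one[of u v] one[of v u] by blast
      next
        case True
        then obtain a b where ab: "a \<in> K0" "E a u" "b \<in> K0" "E b v" by blast
        obtain f n where f: "2 \<le> n" "f 0 = u" "f n = v" "\<And>i. 0 < i \<Longrightarrow> i < n \<Longrightarrow> f i \<in> K0"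
          "\<And>i. i < n \<Longrightarrow> E (f i) (f (Suc i))" and C: "cyc (f ` {..n})" and cardC: "card (f ` {..n}) = Suc n"
          using shortest_cycle[OF Euv rne(1,2), of a b] ab unfolding K0_def by blast
        define C where "C = f ` {..n}"
        have C: "cyc C" using C unfolding C_def .
        have CK: "C \<subseteq> K0 \<union> {u, v}"
        proof
          fix w assume "w \<in> C"
          then obtain i where i: "i \<le> n" "w = f i" unfolding C_def by auto
          then consider "i = 0" | "i = n" | "0 < i" "i < n" by linarith
          then show "w \<in> K0 \<union> {u, v}" using f i by cases auto
        qed
        then have "Suc n \<le> 4" using small[OF C] K0K cardC unfolding C_def by auto
        then have n: "n = 2 \<or> n = 3" using f by linarith
        have f1: "f 1 \<in> C" "f 1 \<in> K0" using f n unfolding C_def by auto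
        \<comment> \<open>Length 4 is the limit here: on a cycle of length 5 the vertex opposite to
          the edge \<open>u v\<close> is two steps from both cops.\<close>
        have mvs: "cmove E u z \<and> cmove E v t \<or> cmove E u t \<and> cmove E v z"
          if z: "z \<in> C" "z \<noteq> u" "z \<noteq> v" and t: "t \<in> C" "E z t" for z t
        proof -
          have "E u (f 1)" using f(5)[of 0] f n by auto
          have zt: "z \<noteq> t" using t E_irr by metis
          have "{..2::nat} = {0, 1, 2}" "{..3::nat} = {0, 1, 2, 3}" by auto
          then have "(n = 2 \<and> C = {u, f 1, v}) \<or> (n = 3 \<and> C = {u, f 1, f 2, v})"
            using n f(2,3) unfolding C_def by (elim disjE) simp_all
          then show ?thesis
          proof
            assume h: "n = 2 \<and> C = {u, f 1, v}"
            then have "E (f 1) v" using f(5)[of 1] f(3) by (simp add: numeral_eq_Suc)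
            then show ?thesis using h z t zt \<open>E u (f 1)\<close> E_sym unfolding cmove_def by auto
          next
            assume h: "n = 3 \<and> C = {u, f 1, f 2, v}"
            then have "E (f 2) v" using f(5)[of 2] f(3) by (simp add: numeral_eq_Suc)
            then show ?thesis using h z t zt \<open>E u (f 1)\<close> E_sym Euv unfolding cmove_def by auto
          qed
        qed
        have rC: "r \<notin> C"
        proof
          assume rC: "r \<in> C"
          then obtain p q where "{w\<in>C. E r w} = {p, q}" "p \<noteq> q" using cyc_nbrs[OF C] by blast
          then have pq: "p \<in> C" "E r p" by blast+
          have "cmove E u r \<or> cmove E v r"
            using mvs[OF rC rne(1,2) pq] by blast
          then show False using \<open>\<not> (cmove E u r \<or> cmove E v r)\<close> by blast
        qed
        define K1 where "K1 = component C r"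
        have K1K0: "K1 \<subseteq> K0"
          unfolding K1_def
        proof (rule component_least[OF rK0])
          fix x y assume "x \<in> K0" "E x y" "y \<notin> C"
          moreover have "u \<in> C" "v \<in> C" unfolding C_def using f by force+
          ultimately show "y \<in> K0" using K0c by blast
        qed
        have K1C: "x \<notin> C" if "x \<in> K1" for x using component_notin[OF rC] that unfolding K1_def by blast
        \<comment> \<open>Otherwise the component of \<open>r\<close> off \<open>C\<close> could be
          left only through \<open>u\<close> and \<open>v\<close>, so it would be all of
          \<open>K0\<close>, although \<open>f 1\<close> lies in \<open>K0\<close> and on
          \<open>C\<close>.\<close>
        obtain z where z: "z \<in> att C r" "z \<noteq> u" "z \<noteq> v"
        proof (rule ccontr)
          assume no: "\<not> thesis"
          have "K0 \<subseteq> K1"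
            unfolding K0_def
          proof (rule component_least)
            show "r \<in> K1" unfolding K1_def by (rule component_refl)
            fix x y assume "x \<in> K1" "E x y" "y \<notin> {u, v}"
            then show "y \<in> K1" using component_att_step[OF rC] that no unfolding K1_def by blast
          qed
          then show False using f1 K1C by blast
        qed
        have zC: "z \<in> C" using z unfolding att_def by blast
        obtain t where t: "t \<in> C" "E z t" "att C r \<subseteq> {z, t}" using att_pair[OF C rC z(1)] by blast
        have K1s: "y \<in> K1 \<or> y = z \<or> y = t" if "x \<in> K1" "E x y" for x y
          using component_att_step[OF rC, of x y] that t(3) unfolding K1_def by blast
        have rK1: "r \<in> K1" unfolding K1_def by (rule component_refl)
        have zK: "z \<in> K0" using zC CK z by blast
        show ?thesis
        proof (rule advance[OF mvs[OF zC z(2,3) t(1,2)]])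
          show "z = t \<or> E z t" using t by blast
          show "r \<noteq> z" "r \<noteq> t" using rC zC t by auto
          fix r' assume r': "cmove E r r'" "r' \<noteq> z" "r' \<noteq> t"
          then have r'K: "r' \<in> K1" using K1s[OF rK1] rK1 unfolding cmove_def by blast
          show "cop_win E {#z, t#} r'"
          proof (rule less.hyps[of K1])
            have "card K1 < card K"
            proof (rule psubset_card_mono[OF finK])
              show "K1 \<subset> K" using K1K0 K0K zK K1C zC by blast
            qed
            then show "2 * card K1 + (if z = t then 0 else 1) < 2 * card K + (if u = v then 0 else 1)"
              by auto
            show "K1 \<subseteq> V" using K1K0 K0K KV by blast
            show "z \<in> V" "t \<in> V" using cyc_V[OF C] zC t by auto
            show "z \<notin> K1" "t \<notin> K1" using K1C zC t by auto
            show "w \<in> K1 \<or> w = z \<or> w = t" if "y \<in> K1" "E y w" for y w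
              using K1s[OF that] .
            show "z = t \<or> E z t" using t by blast
            show "r' \<in> K1" by (rule r'K)
            show "card X \<le> 4" if "cyc X" "X \<subseteq> K1 \<union> {z, t}" for X
              by (rule smaller[OF that]) (use K1K0 K0K zC t CK in auto)
          qed
        qed
      qed
    qed
  qed
qed

text \<open>The edge \<open>s w\<close> is a staging post: the cops may be unable to occupy
  \<open>s t\<close> at once, but from the edge \<open>s w\<close> they can shift onto it in one
  more move. A robber who slips out to \<open>t\<close> meanwhile is captured from \<open>s\<close>.
  Afterwards \<open>S\<close> does not fit into the sealed region, so only cycles of length at most
  4 remain there.\<close>

lemma start_edge:
  assumes S: "cyc S" "5 \<le> card S" and uniq: "\<forall>C. cyc C \<longrightarrow> 5 \<le> card C \<longrightarrow> C = S"
    and r: "r \<in> V" "r \<notin> S" and att: "att S r \<subseteq> {s, t}" and st: "s \<in> S" "t \<in> S" "w \<in> S" "E s t" "E s w"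
    and mv: "cmove E p s \<and> cmove E q w \<or> cmove E p w \<and> cmove E q s"
  shows "cop_win E {#p, q#} r"
proof -
  let ?K = "component S r"
  have K: "y \<in> ?K \<or> y = s \<or> y = t" if "x \<in> ?K" "cmove E x y" for x y
    using component_att_step[OF r(2) that(1), of y] that att unfolding cmove_def by blast
  have KS: "x \<notin> S" if "x \<in> ?K" for x using component_notin[OF r(2) that] .
  have KV: "?K \<subseteq> V" using component_least[of r V S] r E_V by blast
  have win: "cop_win E {#s, t#} x" if x: "x \<in> ?K" for x
  proof (rule region_win[of ?K])
    show "?K \<subseteq> V" by (rule KV)
    show "s \<in> V" "t \<in> V" using cyc_V[OF S(1)] st by auto
    show "s \<notin> ?K" "t \<notin> ?K" using KS st by auto
    show "z \<in> ?K \<or> z = s \<or> z = t" if "y \<in> ?K" "E y z" for y z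
      using K[of y z] that unfolding cmove_def by blast
    show "card C \<le> 4" if C: "cyc C" "C \<subseteq> ?K \<union> {s, t}" for C
    proof (rule ccontr)
      assume "\<not> card C \<le> 4"
      then have "C = S" using uniq C by simp
      then have "S \<subseteq> {s, t}" using C KS by blast
      then have "card S \<le> card {s, t}" by (intro card_mono) auto
      also have "\<dots> \<le> 2" by (simp add: card_insert_if)
      finally show False using S by simp
    qed
  qed (use x st in auto)
  have sw: "s = w \<or> E s w" using st by blast
  show ?thesis
  proof (rule advance[OF mv sw])
    show "r \<noteq> s" "r \<noteq> w" using r st by auto
    fix r' assume r': "cmove E r r'" "r' \<noteq> s" "r' \<noteq> w"
    then have "r' \<in> ?K \<or> r' = t" using K[OF component_refl] by blast
    then show "cop_win E {#s, w#} r'"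
    proof
      assume r'K: "r' \<in> ?K"
      show ?thesis
      proof (rule advance[of s s w t])
        show "r' \<noteq> s" "r' \<noteq> t" using KS[OF r'K] st by auto
        show "cmove E s s \<and> cmove E w t \<or> cmove E s t \<and> cmove E w s"
          using st E_sym unfolding cmove_def by blast
        show "s = t \<or> E s t" using st by blast
        fix x assume "cmove E r' x" "x \<noteq> s" "x \<noteq> t"
        then have "x \<in> ?K" using K[OF r'K] by blast
        then show "cop_win E {#s, t#} x" by (rule win)
      qed
    next
      assume "r' = t"
      then show ?thesis using st by (intro capture_pair) (simp add: cmove_def)
    qed
  qed
qed

lemma cycmap_pos: "cycmap c C \<Longrightarrow> cyc C \<Longrightarrow> z \<in> C \<Longrightarrow> \<exists>j. z = c (Suc j)"
proof -
  assume c: "cycmap c C" and C: "cyc C" and z: "z \<in> C"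
  obtain k where "z = c k" using z c unfolding cycmap_def by blast
  then have "z = c (k + card C)" using c unfolding cycmap_def by metis
  moreover have "k + card C = Suc (k + card C - 1)" using cyc_card[OF C] by simp
  ultimately show ?thesis by metis
qed

lemma att_cycmap:
  assumes C: "cyc C" and c: "cycmap c C" and k: "k \<notin> C"
  shows "\<exists>i<card C. att C k \<subseteq> {c i, c (Suc i)}"
proof -
  have "\<exists>m. att C k \<subseteq> {c m, c (Suc m)}"
  proof (cases "att C k = {}")
    case False
    then obtain z where z: "z \<in> att C k" by blast
    then have zC: "z \<in> C" unfolding att_def by blast
    obtain t where t: "t \<in> C" "E z t" "att C k \<subseteq> {z, t}" using att_pair[OF C k z] by blast
    obtain j where j: "z = c (Suc j)" using cycmap_pos[OF c C zC] by blast
    then have "t = c j \<or> t = c (Suc (Suc j))" using c t unfolding cycmap_def by blast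
    then show ?thesis using t j by (metis insert_commute)
  qed blast
  then obtain m where m: "att C k \<subseteq> {c m, c (Suc m)}" ..
  have "c m = c (m mod card C)" using cycmap_mod[OF c] by simp
  moreover have "c (Suc m) = c (Suc (m mod card C))"
    using cycmap_mod[OF c, of "Suc m"] cycmap_mod[OF c, of "Suc (m mod card C)"] by (simp add: mod_Suc_eq)
  moreover have "m mod card C < card C" using cyc_card[OF C] by simp
  ultimately show ?thesis using m by metis
qed

lemma cops_win_sufficient:
  assumes B: "\<And>C. cyc C \<Longrightarrow> card C \<le> 6"
    and U: "\<And>C C'. cyc C \<Longrightarrow> cyc C' \<Longrightarrow> 5 \<le> card C \<Longrightarrow> 5 \<le> card C' \<Longrightarrow> C = C'"
  shows "cops_win V E 2"
proof (cases "\<exists>S. cyc S \<and> 5 \<le> card S")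
  case True
  then obtain S where S: "cyc S" "5 \<le> card S" by blast
  then obtain a where "a \<in> S" unfolding cyc_def by blast
  then obtain c where c: "cycmap c S" using cycmap_ex[OF S(1)] by blast
  have cS: "c i \<in> S" for i using cycmap_in[OF c] .
  have E1: "E (c i) (c (Suc i))" for i using cycmap_edge[OF c] .
  have E2: "E (c (Suc i)) (c i)" for i using E1 E_sym by blast
  have uniq: "\<forall>C. cyc C \<longrightarrow> 5 \<le> card C \<longrightarrow> C = S" using U S by blast
  have cn: "c (card S) = c 0" using c unfolding cycmap_def by (metis add_0)
  have img: "x \<in> S \<Longrightarrow> \<exists>i<card S. x = c i" for x using c unfolding cycmap_def by blast
  note start = start_edge[OF S uniq]
  have "card S = 5 \<or> card S = 6" using B[OF S(1)] S(2) by arith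
  then show ?thesis
  proof
    assume n: "card S = 5"
    have e: "E (c 0) (c 1)" "E (c 1) (c 2)" "E (c 2) (c 3)" "E (c 3) (c 4)" "E (c 4) (c 0)"
      using E1[of 0] E1[of 1] E1[of 2] E1[of 3] E1[of 4] cn n by (simp_all add: numeral_eq_Suc)
    note e = e e[THEN E_sym]
    \<comment> \<open>The closed neighbourhoods of \<open>c 0\<close> and \<open>c 2\<close> cover
      the 5-cycle; on a 6-cycle the opposite vertices \<open>c 0\<close> and \<open>c 3\<close> do
      so.\<close>
    have "cop_win E {#c 0, c 2#} r" if r: "r \<in> V" for r
    proof (cases "r \<in> S")
      case True
      then obtain i where i: "i < 5" "r = c i" using img n by metis
      then consider "i = 0" | "i = 1" | "i = 2" | "i = 3" | "i = 4" by linarith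
      then show ?thesis
        by cases (use i e in \<open>auto intro!: capture_pair simp: cmove_def\<close>)
    next
      case False
      obtain i where i: "i < 5" "att S r \<subseteq> {c i, c (Suc i)}" using att_cycmap[OF S(1) c False] n by metis
      \<comment> \<open>Below, \<open>start\<close> receives \<open>s\<close>, \<open>t\<close>,
        \<open>w\<close> in this order: \<open>w\<close> is \<open>t\<close> when the cops reach the
        attachment edge in one move, and otherwise the neighbour of \<open>s\<close> on the other
        side.\<close>
      then consider "att S r \<subseteq> {c 0, c 1}" | "att S r \<subseteq> {c 2, c 1}" | "att S r \<subseteq> {c 2, c 3}"
        | "att S r \<subseteq> {c 3, c 4}" | "att S r \<subseteq> {c 0, c 4}"
        using cn n by (auto simp: numeral_eq_Suc less_Suc_eq insert_commute)
      then show ?thesis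
      proof cases
        case 1 from this show ?thesis
          by (rule start[OF r False, of "c 0" "c 1" "c 1"]) (use cS e in \<open>auto simp: cmove_def\<close>)
      next
        case 2 from this show ?thesis
          by (rule start[OF r False, of "c 2" "c 1" "c 1"]) (use cS e in \<open>auto simp: cmove_def\<close>)
      next
        case 3 from this show ?thesis
          by (rule start[OF r False, of "c 2" "c 3" "c 1"]) (use cS e in \<open>auto simp: cmove_def\<close>)
      next
        case 4 from this show ?thesis
          by (rule start[OF r False, of "c 3" "c 4" "c 4"]) (use cS e in \<open>auto simp: cmove_def\<close>)
      next
        case 5 from this show ?thesis
          by (rule start[OF r False, of "c 0" "c 4" "c 1"]) (use cS e in \<open>auto simp: cmove_def\<close>)
      qed
    qed
    then show ?thesis
      unfolding cops_win_def using cS cyc_V[OF S(1)] by (intro exI[of _ "{#c 0, c 2#}"]) auto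
  next
    assume n: "card S = 6"
    have e: "E (c 0) (c 1)" "E (c 1) (c 2)" "E (c 2) (c 3)" "E (c 3) (c 4)" "E (c 4) (c 5)" "E (c 5) (c 0)"
      using E1[of 0] E1[of 1] E1[of 2] E1[of 3] E1[of 4] E1[of 5] cn n by (simp_all add: numeral_eq_Suc)
    note e = e e[THEN E_sym]
    have "cop_win E {#c 0, c 3#} r" if r: "r \<in> V" for r
    proof (cases "r \<in> S")
      case True
      then obtain i where i: "i < 6" "r = c i" using img n by metis
      then consider "i = 0" | "i = 1" | "i = 2" | "i = 3" | "i = 4" | "i = 5" by linarith
      then show ?thesis
        by cases (use i e in \<open>auto intro!: capture_pair simp: cmove_def\<close>)
    next
      case False
      obtain i where i: "i < 6" "att S r \<subseteq> {c i, c (Suc i)}" using att_cycmap[OF S(1) c False] n by metis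
      then consider "att S r \<subseteq> {c 1, c 0}" | "att S r \<subseteq> {c 1, c 2}" | "att S r \<subseteq> {c 2, c 3}"
        | "att S r \<subseteq> {c 4, c 3}" | "att S r \<subseteq> {c 4, c 5}" | "att S r \<subseteq> {c 5, c 0}"
        using cn n by (auto simp: numeral_eq_Suc less_Suc_eq insert_commute)
      then show ?thesis
      proof cases
        case 1 from this show ?thesis
          by (rule start[OF r False, of "c 1" "c 0" "c 2"]) (use cS e in \<open>auto simp: cmove_def\<close>)
      next
        case 2 from this show ?thesis
          by (rule start[OF r False, of "c 1" "c 2" "c 2"]) (use cS e in \<open>auto simp: cmove_def\<close>)
      next
        case 3 from this show ?thesis
          by (rule start[OF r False, of "c 2" "c 3" "c 1"]) (use cS e in \<open>auto simp: cmove_def\<close>)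
      next
        case 4 from this show ?thesis
          by (rule start[OF r False, of "c 4" "c 3" "c 5"]) (use cS e in \<open>auto simp: cmove_def\<close>)
      next
        case 5 from this show ?thesis
          by (rule start[OF r False, of "c 4" "c 5" "c 5"]) (use cS e in \<open>auto simp: cmove_def\<close>)
      next
        case 6 from this show ?thesis
          by (rule start[OF r False, of "c 5" "c 0" "c 4"]) (use cS e in \<open>auto simp: cmove_def\<close>)
      qed
    qed
    then show ?thesis
      unfolding cops_win_def using cS cyc_V[OF S(1)] by (intro exI[of _ "{#c 0, c 3#}"]) auto
  qed
next
  case False
  \<comment> \<open>All induced cycles now have length at most 4, so the shrinking can begin with
    both cops on an arbitrary vertex.\<close>
  obtain u where u: "u \<in> V" using V_ne by blast
  have "cop_win E {#u, u#} r" if r: "r \<in> V" for r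
  proof (cases "r = u")
    case True
    then show ?thesis by (intro capture_pair) (simp add: cmove_def)
  next
    case ru: False
    show ?thesis
    proof (rule region_win[of "V - {u}"])
      show "card C \<le> 4" if "cyc C" for C using False that by (metis not_less_eq_eq numeral_eq_Suc pred_numeral_simps(3) Num.pred_numeral_simps(2) BitM.simps(2))
      show "y \<in> V - {u} \<or> y = u \<or> y = u" if "E x y" for x y using E_V that by blast
    qed (use u r ru in auto)
  qed
  then show ?thesis
    unfolding cops_win_def using u by (intro exI[of _ "{#u, u#}"]) auto
qed

text \<open>If both neighbours \<open>a\<close>, \<open>b\<close> of \<open>r\<close> on
  \<open>C\<close> were dominated, then in every case they would have a common neighbour on
  \<open>C\<close> other than \<open>r\<close>, or both attach to one component off
  \<open>C\<close>. The first contradicts length at least 5, the second contradicts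
  \<open>att_adj\<close>.\<close>

lemma robber_escape:
  assumes C: "cyc C" "5 \<le> card C" and r: "r \<in> C"
    and c: "c \<noteq> r" "c' \<noteq> r" "E c r" "cmove E c' c"
  shows "\<exists>b\<in>C. E r b \<and> \<not> cmove E c b \<and> \<not> cmove E c' b"
proof (rule ccontr)
  assume neg: "\<not> ?thesis"
  obtain f0 where f0: "cycmap f0 C" "f0 0 = r" using cycmap_ex[OF C(1) r] by blast
  \<comment> \<open>The shift puts \<open>r\<close> at index 2, in the middle of \<open>f 0\<close>
    to \<open>f 4\<close>, so that no index drops below 0.\<close>
  define f where "f i = f0 (i + (card C - 2))" for i
  have nb: "{w\<in>C. E (f (Suc i)) w} = {f i, f (Suc (Suc i))}" for i
    using f0 unfolding cycmap_def f_def by simp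
  have fC: "f i \<in> C" for i unfolding f_def using cycmap_in[OF f0(1)] .
  have "2 + (card C - 2) = 0 + card C" using C by simp
  then have "f 2 = f0 (0 + card C)" unfolding f_def by metis
  then have f2: "f 2 = r" using f0 unfolding cycmap_def by metis
  have dist: "f i \<noteq> f j" if "i < j" "j < card C" for i j
  proof
    assume "f i = f j"
    let ?m = "card C"
    have "f0 ((i + (?m - 2)) mod ?m) = f0 ((j + (?m - 2)) mod ?m)"
      using \<open>f i = f j\<close> cycmap_mod[OF f0(1)] unfolding f_def by simp
    moreover have "inj_on f0 {..<?m}" using f0 unfolding cycmap_def by blast
    ultimately have "(i + (?m - 2)) mod ?m = (j + (?m - 2)) mod ?m"
      using C by (auto dest!: inj_onD)
    then have "?m dvd (j + (?m - 2)) - (i + (?m - 2))"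
      using that mod_eq_dvd_iff_nat[of "i + (?m - 2)" "j + (?m - 2)" ?m] by simp
    then have "?m dvd j - i" by (simp only: diff_cancel2)
    then show False using that by (auto dest: dvd_imp_le)
  qed
  have d: "f 1 \<noteq> f 3" "f 0 \<noteq> f 3" "f 2 \<noteq> f 3" "f 0 \<noteq> f 4" "f 0 \<noteq> f 2" "f 2 \<noteq> f 4" "f 1 \<noteq> f 2"
    using dist C by auto
  have N1: "{w\<in>C. E (f 1) w} = {f 0, f 2}" and N2: "{w\<in>C. E r w} = {f 1, f 3}"
    and N3: "{w\<in>C. E (f 3) w} = {f 2, f 4}"
    using nb[of 0] nb[of 1] nb[of 2] f2 by (simp_all add: numeral_eq_Suc)
  obtain a b where a: "a = f 1" and b: "b = f 3" by blast
  have ab: "a \<in> C" "b \<in> C" "E r a" "E r b" using N2 fC a b by blast+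
  have nab: "\<not> cmove E a b"
  proof
    assume "cmove E a b"
    then have "f 3 = f 1 \<or> f 3 \<in> {w\<in>C. E (f 1) w}" using ab(2) a b unfolding cmove_def by auto
    then have "f 3 \<in> {f 1, f 0, f 2}" unfolding N1 by blast
    then show False using d(1-3) by auto
  qed
  have common: "w = r" if "w \<in> C" "E a w" "E b w" for w
  proof -
    have "w \<in> {f 0, f 2} \<inter> {f 2, f 4}" using N1 N3 that a b by blast
    then show ?thesis using d f2 by auto
  qed
  have dom: "cmove E c a \<or> cmove E c' a" "cmove E c b \<or> cmove E c' b" using neg ab by blast+
  have attI: "y \<in> att C x" if "x \<notin> C" "y \<in> C" "E x y" for x y
    using that component_refl unfolding att_def by blast
  show False
  proof (cases "c \<in> C")
    case cC: True
    then have c_ab: "c = a \<or> c = b" using N2 c E_sym a b by blast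
    have c'dom: "E c' a \<and> E c' b"
    proof -
      have "c' \<noteq> a \<or> c' \<noteq> b" using nab unfolding cmove_def by blast
      then show ?thesis using c_ab dom nab c(4) E_sym unfolding cmove_def by metis
    qed
    show False
    proof (cases "c' \<in> C")
      case True
      then show False using common[of c'] c'dom E_sym c(2) by blast
    next
      case False
      then have "a = b \<or> E a b" using att_adj[OF C(1) False] attI ab c'dom by blast
      then show False using nab unfolding cmove_def by blast
    qed
  next
    case cC: False
    have rat: "r \<in> att C c" using attI[OF cC r c(3)] .
    show False
    proof (cases "c' \<in> C")
      case True
      then have "E c c'" using c cC E_sym unfolding cmove_def by auto
      then have at: "c' \<in> att C c" using attI[OF cC True] by blast
      then have "E r c'" using att_adj[OF C(1) cC rat at] c(2) by blast
      then have c_ab: "c' = a \<or> c' = b" using N2 True a b by blast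
      have "E c a" "E c b"
        using c_ab dom nab cC ab \<open>E c c'\<close> E_sym unfolding cmove_def by metis+
      then have "a = b \<or> E a b" using att_adj[OF C(1) cC] attI cC ab by blast
      then show False using nab unfolding cmove_def by blast
    next
      case False
      have "E c c' \<or> c = c'" using c(4) E_sym unfolding cmove_def by blast
      then have c'K: "c' \<in> component C c" using component_step[OF cC component_refl] False component_refl by blast
      have "a \<in> att C c" "b \<in> att C c"
        using dom ab cC False c'K component_refl[of c C] unfolding att_def cmove_def by blast+
      then have "a = b \<or> E a b" using att_adj[OF C(1) cC] by blast
      then show False using nab unfolding cmove_def by blast
    qed
  qed
qed

section \<open>Dominating long cycles with two vertices\<close>

lemma card_dom:
  assumes C: "cyc C"
  shows "card {w\<in>C. cmove E z w} \<le> 3" "z \<notin> C \<Longrightarrow> card {w\<in>C. cmove E z w} \<le> 2"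
proof -
  show 2: "card {w\<in>C. cmove E z w} \<le> 2" if z: "z \<notin> C"
  proof (rule card_le_2I)
    show "finite {w\<in>C. cmove E z w}" using cyc_fin[OF C] by simp
    \<comment> \<open>Off the cycle a vertex dominates only attachments of its own
      component.\<close>
    have "{w\<in>C. cmove E z w} \<subseteq> att C z"
      using z component_refl[of z C] unfolding att_def cmove_def by blast
    then show "a = b \<or> b = c \<or> a = c"
      if "a \<in> {w\<in>C. cmove E z w}" "b \<in> {w\<in>C. cmove E z w}" "c \<in> {w\<in>C. cmove E z w}" for a b c
      using att_three[OF C z, of a b c] that by blast
  qed
  show "card {w\<in>C. cmove E z w} \<le> 3"
  proof (cases "z \<in> C")
    case True
    then obtain p q where "{w\<in>C. E z w} = {p, q}" using cyc_nbrs[OF C] by blast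
    then have "{w\<in>C. cmove E z w} = {z, p, q}" using True unfolding cmove_def by blast
    then show ?thesis by (simp add: card_insert_if)
  qed (use 2 in force)
qed

text \<open>Each vertex of \<open>C\<close> already has both of its \<open>C'\<close>-neighbours in
  \<open>C\<close>, and \<open>C'\<close> is connected.\<close>

lemma cyc_subset_eq:
  assumes C: "cyc C" "cyc C'" "C \<subseteq> C'"
  shows "C = C'"
proof
  have same: "{w\<in>C. E v w} = {w\<in>C'. E v w}" if "v \<in> C" for v
  proof (rule card_subset_eq)
    show "finite {w\<in>C'. E v w}" using cyc_fin[OF C(2)] by simp
    show "{w\<in>C. E v w} \<subseteq> {w\<in>C'. E v w}" using C by blast
    show "card {w\<in>C. E v w} = card {w\<in>C'. E v w}" using C that unfolding cyc_def by auto
  qed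
  obtain u where u: "u \<in> C" using C unfolding cyc_def by blast
  show "C' \<subseteq> C"
  proof
    fix v assume "v \<in> C'"
    then have "(\<lambda>x y. E x y \<and> x \<in> C' \<and> y \<in> C')\<^sup>*\<^sup>* u v" using C u unfolding cyc_def by blast
    then show "v \<in> C" by (induction rule: rtranclp_induct) (use u same in blast)+
  qed
qed (rule C(3))

text \<open>Following \<open>C2\<close> from \<open>k\<close>, the first and the last vertex outside
  the component are attachments, hence adjacent. A further vertex of \<open>C2\<close> that is
  neither in the component nor an attachment would lie strictly between them and turn their edge
  into a chord of \<open>C2\<close>.\<close>

lemma cyc_sep:
  assumes C1: "cyc C1" and C2: "cyc C2" and k: "k \<in> C2" "k \<notin> C1"
  shows "C2 \<subseteq> component C1 k \<union> att C1 k"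
proof (rule ccontr)
  let ?K = "component C1 k" let ?n = "card C2"
  assume "\<not> ?thesis"
  then obtain m0 where m0: "m0 \<in> C2" "m0 \<notin> ?K" "m0 \<notin> att C1 k" by blast
  obtain c where c: "cycmap c C2" "c 0 = k" using cycmap_ex[OF C2 k(1)] by blast
  have n: "3 \<le> ?n" using cyc_card[OF C2] .
  have cm: "c ` {..<?n} = C2" "c ?n = c 0"
    using c unfolding cycmap_def by (blast, metis add_0)
  obtain m where m: "m < ?n" "c m = m0" using m0(1) cm(1) by (metis imageE lessThan_iff)
  define i where "i = (LEAST i. c i \<notin> ?K)"
  have i: "c i \<notin> ?K" "i \<le> m"
    using LeastI[of "\<lambda>i. c i \<notin> ?K" m] Least_le[of "\<lambda>i. c i \<notin> ?K" m] m m0 unfolding i_def by auto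
  have imin: "c x \<in> ?K" if "x < i" for x
    using not_less_Least[of x "\<lambda>i. c i \<notin> ?K"] that unfolding i_def by blast
  have i0: "i \<noteq> 0" using i(1) c(2) component_refl[of k C1] by metis
  then have ia: "c i \<in> att C1 k"
    using component_att_step[OF k(2) imin[of "i - 1"], of "c i"] cycmap_edge[OF c(1), of "i - 1"] i(1) by simp
  obtain j where j: "m \<le> j" "j < ?n" "c j \<notin> ?K" and jmax: "\<And>x. j < x \<Longrightarrow> x < ?n \<Longrightarrow> c x \<in> ?K"
  proof -
    let ?X = "{x. x < ?n \<and> c x \<notin> ?K}"
    have X: "finite ?X" "m \<in> ?X" using m m0 by auto
    show ?thesis
    proof (rule that[of "Max ?X"])
      show "m \<le> Max ?X" using X by simp
      have "Max ?X \<in> ?X" using X Max_in by blast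
      then show "Max ?X < ?n" "c (Max ?X) \<notin> ?K" by auto
      show "c x \<in> ?K" if "Max ?X < x" "x < ?n" for x
      proof (rule ccontr)
        assume "c x \<notin> ?K"
        then have "x \<in> ?X" using that by blast
        then have "x \<le> Max ?X" by (rule Max_ge[OF X(1)])
        then show False using that by simp
      qed
    qed
  qed
  have "c (Suc j) \<in> ?K"
    using jmax[of "Suc j"] j cm c(2) component_refl[of k C1] by (cases "Suc j = ?n") auto
  then have ja: "c j \<in> att C1 k"
    using component_att_step[OF k(2), of "c (Suc j)" "c j"] cycmap_edge[OF c(1), of j] E_sym j by blast
  have "c i \<noteq> c m" "c j \<noteq> c m" using ia ja m m0 by auto
  then have lt: "i < m" "m < j" using i j by (auto simp: order.order_iff_strict)
  have "c i = c j \<or> E (c i) (c j)" using att_adj[OF C1 k(2) ia ja] .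
  moreover have inj: "c x \<noteq> c y" if "x < y" "y < ?n" for x y
    using c(1) that inj_onD[of c "{..<?n}" x y] unfolding cycmap_def by auto
  have "c i \<noteq> c j" using inj[of i j] lt j by simp
  ultimately have "c j \<in> {w\<in>C2. E (c (Suc (i - 1))) w}" using cycmap_in[OF c(1)] i0 by simp
  moreover have "{w\<in>C2. E (c (Suc (i - 1))) w} = {c (i - 1), c (Suc (Suc (i - 1)))}"
    using c(1) unfolding cycmap_def by blast
  ultimately have "c j = c (i - 1) \<or> c j = c (Suc i)" using i0 by auto
  moreover have "c j \<noteq> c (i - 1)" using imin[of "i - 1"] i0 j by auto
  moreover have "c (Suc i) \<noteq> c j" using inj[of "Suc i" j] lt j by simp
  ultimately show False by auto
qed

lemma att_edge:
  assumes C: "cyc C" and k: "k \<notin> C"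
  shows "\<exists>s t. s \<in> C \<and> t \<in> C \<and> E s t \<and> att C k \<subseteq> {s, t}"
proof -
  obtain a where "a \<in> C" using C unfolding cyc_def by blast
  then obtain c where c: "cycmap c C" using cycmap_ex[OF C] by blast
  show ?thesis
    using att_cycmap[OF C c k] cycmap_in[OF c] cycmap_edge[OF c] by metis
qed

lemma card_minus_edge:
  assumes C: "cyc C" "5 \<le> card C" and st: "s \<in> C" "t \<in> C" "E s t"
  shows "3 \<le> card (C - {s, t})" "card {w\<in>C - {s, t}. cmove E s w} \<le> 1"
proof -
  have "card (C - {s, t}) \<ge> card C - card {s, t}" by (rule diff_card_le_card_Diff) simp
  moreover have "card {s, t} \<le> 2" by (simp add: card_insert_if)
  ultimately show "3 \<le> card (C - {s, t})" using C by linarith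
  obtain p q where pq: "{w\<in>C. E s w} = {p, q}" using cyc_nbrs[OF C(1) st(1)] by blast
  then have "t = p \<or> t = q" using st by blast
  then obtain q' where "{w\<in>C. E s w} = {t, q'}" using pq by blast
  then have "{w\<in>C - {s, t}. cmove E s w} \<subseteq> {q'}" unfolding cmove_def by blast
  then show "card {w\<in>C - {s, t}. cmove E s w} \<le> 1"
    using card_mono[of "{q'}"] by fastforce
qed

text \<open>Off \<open>C1\<close>, reaching \<open>z2\<close> would place \<open>z\<close> in the
  component of \<open>k\<close>, whereas reaching \<open>z1\<close>, which is no attachment, would
  place it outside.\<close>

lemma dom_side:
  assumes C1: "cyc C1" and k: "k \<notin> C1" and sub: "C2 \<subseteq> component C1 k \<union> att C1 k"
    and att: "att C1 k \<subseteq> B1" and int: "C1 \<inter> C2 \<subseteq> B2"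
    and z1: "cmove E z z1" "z1 \<in> C1 - B1" and z2: "cmove E z z2" "z2 \<in> C2 - B2"
  shows "z \<in> C1"
proof (rule ccontr)
  assume z: "z \<notin> C1"
  have attC: "att C1 k \<subseteq> C1" unfolding att_def by blast
  have zK: "z \<notin> component C1 k"
    using component_att_step[OF k, of z z1] component_notin[OF k] z1 att unfolding cmove_def by blast
  have "z2 \<in> component C1 k"
    using z2 sub attC int by blast
  then show False
    using z2(1) z zK component_att_step[OF k, of z2 z] attC E_sym unfolding cmove_def by blast
qed

text \<open>Each of \<open>x\<close>, \<open>y\<close> spends its whole capacity of three on one
  cycle, so \<open>x\<close> lies on \<open>C1\<close> and misses both \<open>s1\<close> and
  \<open>t1\<close>, while \<open>y\<close> misses \<open>s2\<close>. Then \<open>x\<close> has to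
  be adjacent to \<open>s2\<close>. Either this makes \<open>x\<close> an attachment, hence one of
  \<open>s1\<close>, \<open>t1\<close>, which \<open>x\<close> does not dominate although it
  dominates itself; or \<open>s2\<close> is one of \<open>s1\<close>, \<open>t1\<close>.\<close>

lemma dom_cross:
  assumes C1: "cyc C1" "5 \<le> card C1" and k: "k \<notin> C1" and sub: "C2 \<subseteq> component C1 k \<union> att C1 k"
    and e1: "s1 \<in> C1" "t1 \<in> C1" "E s1 t1" "att C1 k \<subseteq> {s1, t1}"
    and C2: "cyc C2" "5 \<le> card C2" and e2: "s2 \<in> C2" "t2 \<in> C2" "E s2 t2"
    and x: "x \<notin> C1 \<inter> C2" and dom: "\<And>w. w \<in> C2 \<Longrightarrow> cmove E x w \<or> cmove E y w"
    and xD: "\<And>w. w \<in> C1 - {s1, t1} \<Longrightarrow> cmove E x w"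
    and yD: "\<And>w. w \<in> C2 - {s2, t2} \<Longrightarrow> cmove E y w"
  shows False
proof -
  have full: "z \<in> C \<and> C - {s, t} = {w\<in>C. cmove E z w}"
    if C: "cyc C" "5 \<le> card C" and st: "s \<in> C" "t \<in> C" "E s t" and D: "\<And>w. w \<in> C - {s, t} \<Longrightarrow> cmove E z w"
    for C s t z
  proof -
    have fin: "finite {w\<in>C. cmove E z w}" using cyc_fin[OF C(1)] by simp
    have sub: "C - {s, t} \<subseteq> {w\<in>C. cmove E z w}" using D by blast
    have "card {w\<in>C. cmove E z w} \<le> card (C - {s, t})"
      using card_dom(1)[OF C(1), of z] card_minus_edge(1)[OF C st] by linarith
    then have "C - {s, t} = {w\<in>C. cmove E z w}" using card_seteq[OF fin sub] by blast
    moreover have "z \<in> C"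
      using card_dom(2)[OF C(1), of z] card_minus_edge(1)[OF C st] card_mono[OF fin sub] by linarith
    ultimately show ?thesis by blast
  qed
  have X: "x \<in> C1" "C1 - {s1, t1} = {w\<in>C1. cmove E x w}" using full[OF C1 e1(1,2,3) xD] by blast+
  have Y: "C2 - {s2, t2} = {w\<in>C2. cmove E y w}" using full[OF C2 e2 yD] by blast
  have "\<not> cmove E y s2" using Y e2 by blast
  then have "cmove E x s2" using dom e2 by blast
  then have xs: "E x s2" using X(1) x e2 unfolding cmove_def by blast
  have "cmove E x x" unfolding cmove_def by simp
  then have xn: "x \<notin> {s1, t1}" using X by blast
  have "s2 \<in> component C1 k \<or> s2 \<in> att C1 k" using sub e2 by blast
  then show False
  proof
    assume "s2 \<in> component C1 k"
    then have "x \<in> att C1 k" using xs E_sym X(1) unfolding att_def by blast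
    then show False using xn e1 by blast
  next
    assume s2: "s2 \<in> att C1 k"
    then have "s2 \<in> C1" "s2 \<in> {s1, t1}" using e1 unfolding att_def by blast+
    moreover have "cmove E x s2" using xs unfolding cmove_def by blast
    ultimately show False using X(2) by blast
  qed
qed

text \<open>Each cycle keeps at least three vertices after removal of the edge through which the
  other attaches. A vertex reaching both remainders lies on both cycles, hence on both removed
  edges, and dominates at most one vertex of each remainder. This is too little even for two such
  vertices, so each of \<open>x\<close>, \<open>y\<close> serves only one remainder and
  \<open>dom_cross\<close> applies.\<close>

lemma two_cycles_not_dominated:
  assumes C1: "cyc C1" "5 \<le> card C1" and C2: "cyc C2" "5 \<le> card C2" and ne: "C1 \<noteq> C2"
    and dom: "\<And>w. w \<in> C1 \<union> C2 \<Longrightarrow> cmove E x w \<or> cmove E y w"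
  shows False
proof -
  obtain k where k: "k \<in> C2" "k \<notin> C1" using cyc_subset_eq[OF C2(1) C1(1)] ne by blast
  obtain l where l: "l \<in> C1" "l \<notin> C2" using cyc_subset_eq[OF C1(1) C2(1)] ne by blast
  note sep1 = cyc_sep[OF C1(1) C2(1) k] and sep2 = cyc_sep[OF C2(1) C1(1) l]
  obtain s1 t1 where e1: "s1 \<in> C1" "t1 \<in> C1" "E s1 t1" "att C1 k \<subseteq> {s1, t1}"
    using att_edge[OF C1(1) k(2)] by blast
  obtain s2 t2 where e2: "s2 \<in> C2" "t2 \<in> C2" "E s2 t2" "att C2 l \<subseteq> {s2, t2}"
    using att_edge[OF C2(1) l(2)] by blast
  let ?D1 = "C1 - {s1, t1}" and ?D2 = "C2 - {s2, t2}"
  have I1: "C1 \<inter> C2 \<subseteq> {s1, t1}" using sep1 component_notin[OF k(2)] e1(4) by blast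
  have I2: "C2 \<inter> C1 \<subseteq> {s2, t2}" using sep2 component_notin[OF l(2)] e2(4) by blast
  then have I2': "C1 \<inter> C2 \<subseteq> {s2, t2}" by blast
  have both: "z \<in> C1 \<inter> C2" if "cmove E z z1" "z1 \<in> ?D1" "cmove E z z2" "z2 \<in> ?D2" for z z1 z2
    using dom_side[OF C1(1) k(2) sep1 e1(4) I2' that] dom_side[OF C2(1) l(2) sep2 e2(4) _ that(3,4,1,2)] I1
    by blast
  have c1: "3 \<le> card ?D1" and c2: "3 \<le> card ?D2"
    using card_minus_edge(1) C1 C2 e1 e2 by blast+
  have le1: "card {w\<in>?D1. cmove E z w} \<le> 1" if "z \<in> {s1, t1}" for z
    using that card_minus_edge(2)[OF C1 e1(1,2,3)] card_minus_edge(2)[OF C1 e1(2,1) E_sym[OF e1(3)]]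
    by (auto simp: insert_commute)
  have le2: "card {w\<in>?D2. cmove E z w} \<le> 1" if "z \<in> {s2, t2}" for z
    using that card_minus_edge(2)[OF C2 e2(1,2,3)] card_minus_edge(2)[OF C2 e2(2,1) E_sym[OF e2(3)]]
    by (auto simp: insert_commute)
  have fin: "finite ?D1" "finite ?D2" using cyc_fin C1 C2 by auto
  have left: "\<exists>w\<in>D. \<not> cmove E z w" if "3 \<le> card D" "finite D" "card {w\<in>D. cmove E z w} \<le> 1" for D z
  proof (rule ccontr)
    assume "\<not> ?thesis"
    then have "{w\<in>D. cmove E z w} = D" by blast
    then show False using that by simp
  qed
  \<comment> \<open>If \<open>z\<close> were on both cycles, its partner would have to reach both
    remainders and so be on both cycles too; together they dominate at most two of the three
    vertices.\<close>
  have no_int: "z \<notin> C1 \<inter> C2" if zz: "\<And>w. w \<in> C1 \<union> C2 \<Longrightarrow> cmove E z w \<or> cmove E z' w" for z z'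
  proof
    assume z: "z \<in> C1 \<inter> C2"
    have z12: "z \<in> {s1, t1}" "z \<in> {s2, t2}" using z I1 I2' by blast+
    obtain w1 where w1: "w1 \<in> ?D1" "\<not> cmove E z w1" using left[OF c1 fin(1) le1[OF z12(1)]] by blast
    obtain w2 where w2: "w2 \<in> ?D2" "\<not> cmove E z w2" using left[OF c2 fin(2) le2[OF z12(2)]] by blast
    have "z' \<in> C1 \<inter> C2" using both[of z' w1 w2] zz[of w1] zz[of w2] w1 w2 by blast
    then have z': "z' \<in> {s1, t1}" using I1 by blast
    have "?D1 \<subseteq> {w\<in>?D1. cmove E z w} \<union> {w\<in>?D1. cmove E z' w}" using zz by blast
    then have "card ?D1 \<le> card ({w\<in>?D1. cmove E z w} \<union> {w\<in>?D1. cmove E z' w})"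
      using fin by (intro card_mono) auto
    also have "\<dots> \<le> card {w\<in>?D1. cmove E z w} + card {w\<in>?D1. cmove E z' w}" by (rule card_Un_le)
    also have "\<dots> \<le> 1 + 1" using le1[OF z12(1)] le1[OF z'] by (rule add_mono)
    finally show False using c1 by simp
  qed
  have xy: "x \<notin> C1 \<inter> C2" "y \<notin> C1 \<inter> C2" using no_int[of x y] no_int[of y x] dom by blast+
  obtain w1 w2 where w: "w1 \<in> ?D1" "w2 \<in> ?D2"
    using c1 c2 by (metis card.empty ex_in_conv not_numeral_le_zero)
  note cross = dom_cross[OF C1 k(2) sep1 e1 C2 e2(1,2,3)]
  show False
  proof (cases "\<exists>w\<in>?D1. cmove E x w")
    case True
    then have "\<not> cmove E x v" if "v \<in> ?D2" for v using both xy that by blast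
    then have yD: "cmove E y v" if "v \<in> ?D2" for v using dom that by blast
    then have "\<not> cmove E y v" if "v \<in> ?D1" for v using both[of y v w2] xy w that by blast
    then have xD: "cmove E x v" if "v \<in> ?D1" for v using dom that by blast
    show False by (rule cross[OF xy(1) _ xD yD]) (use dom in blast)
  next
    case False
    then have yD: "cmove E y v" if "v \<in> ?D1" for v using dom that by blast
    then have "\<not> cmove E y v" if "v \<in> ?D2" for v using both[of y w1 v] xy w that by blast
    then have xD: "cmove E x v" if "v \<in> ?D2" for v using dom that by blast
    show False by (rule cross[OF xy(2) _ yD xD]) (use dom in blast)
  qed
qed

text \<open>From a vertex not dominated at the start on a cycle of length at least 5, the robber
  evades with that cycle as \<open>S\<close>. So the initial positions dominate all these cycles,
  and 3 + 3 bounds their length.\<close>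

lemma cops_win_necessary:
  assumes win: "cops_win V E 2"
  shows "(\<forall>C. cyc C \<longrightarrow> card C \<le> 6) \<and>
    (\<forall>C C'. cyc C \<longrightarrow> cyc C' \<longrightarrow> 5 \<le> card C \<longrightarrow> 5 \<le> card C' \<longrightarrow> C = C')"
proof -
  obtain M where M: "size M = 2" "\<And>r. r \<in> V \<Longrightarrow> cop_win E M r"
    using win unfolding cops_win_def by blast
  then obtain x y where xy: "M = {#x, y#}" 
    by (metis One_nat_def numeral_2_eq_2 size_1_singleton_mset size_eq_Suc_imp_eq_union size_add_mset nat.inject)
  have dom: "cmove E x r \<or> cmove E y r" if C: "cyc C" "5 \<le> card C" and r: "r \<in> C" for C r
  proof -
    have "\<not> ((\<forall>c\<in>#M. \<not> cmove E c r) \<and> (size M \<le> 1 \<or> size M = 2 \<and> r \<in> C))"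
    proof (rule robber_evades)
      show "cop_win E M r" using M(2) cyc_V[OF C(1) r] by blast
    qed (use E_sym robber_escape[OF C] in blast)+
    then show ?thesis using M(1) r xy by auto
  qed
  have "card C \<le> 6" if C: "cyc C" for C
  proof (cases "5 \<le> card C")
    case True
    have "C \<subseteq> {w\<in>C. cmove E x w} \<union> {w\<in>C. cmove E y w}" using dom[OF C True] by blast
    then have "card C \<le> card ({w\<in>C. cmove E x w} \<union> {w\<in>C. cmove E y w})"
      using cyc_fin[OF C] by (intro card_mono) auto
    also have "\<dots> \<le> card {w\<in>C. cmove E x w} + card {w\<in>C. cmove E y w}" by (rule card_Un_le)
    also have "\<dots> \<le> 3 + 3" by (intro add_mono card_dom(1) C)
    finally show ?thesis by simp
  qed simp
  moreover have "C = C'" if "cyc C" "cyc C'" "5 \<le> card C" "5 \<le> card C'" for C C'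
    using two_cycles_not_dominated[of C C' x y] dom[of C] dom[of C'] that by blast
  ultimately show ?thesis by blast
qed

end

text \<open>A single cop on a vertex that is not universal leaves a safe start, and against one cop
  the evasion works with \<open>S\<close> empty.\<close>

lemma few_cops_lose:
  assumes g: "graph V E" and ne: "V \<noteq> {}" and nu: "\<not> (\<exists>v\<in>V. universal_vertex V E v)" and k: "k \<le> 1"
  shows "\<not> cops_win V E k"
proof
  assume "cops_win V E k"
  then obtain M where M: "size M = k" "set_mset M \<subseteq> V" "\<And>r. r \<in> V \<Longrightarrow> cop_win E M r"
    unfolding cops_win_def by blast
  have "\<exists>r\<in>V. \<forall>c\<in>#M. \<not> cmove E c r"
  proof (cases "M = {#}")
    case True
    then show ?thesis using ne by auto
  next
    case False
    then obtain x where x: "M = {#x#}" using M(1) k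
      by (metis One_nat_def le_SucE le_zero_eq size_1_singleton_mset size_eq_0_iff_empty)
    then obtain r where "r \<in> V" "r \<noteq> x" "\<not> E x r"
      using nu M(2) unfolding universal_vertex_def by auto
    then show ?thesis using x unfolding cmove_def by auto
  qed
  then obtain r where r: "r \<in> V" "\<forall>c\<in>#M. \<not> cmove E c r" by blast
  have "\<And>x y. E x y \<Longrightarrow> E y x" using g unfolding graph_def by blast
  then show False
    using robber_evades[of E "{}" M r] M(3)[OF r(1)] r(2) M(1) k by auto
qed

theorem theorem4:
  fixes V :: "'a set" and E :: "'a \<Rightarrow> 'a \<Rightarrow> bool"
    and \<sigma> :: "'a \<Rightarrow> 'a \<Rightarrow> 'a" and Of :: "('a \<times> 'a) set"
  assumes "graph V E"
    and "connected_graph V E"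
    and "\<not> (\<exists>v\<in>V. universal_vertex V E v)"
    and "outerplanar_embedding V E \<sigma> Of"
  shows "attacking_cop_number V E = 2 \<longleftrightarrow>
    card {F \<in> internal_faces V E \<sigma> Of. card F \<in> {5, 6}} \<le> 1
    \<and> \<not> (\<exists>F\<in>internal_faces V E \<sigma> Of. card F > 6)"
proof -
  interpret outerplane V E \<sigma> Of
    using assms by unfold_locales
  have lose: "\<not> cops_win V E k" if "k \<le> 1" for k
    by (rule few_cops_lose[OF assms(1) V_ne assms(3) that])
  \<comment> \<open>With a cop on every vertex, passing already captures; this guarantees that the
    \<open>LEAST\<close> is attained.\<close>
  have "cop_win E (mset_set V) r" if "r \<in> V" for r
    using that finV
    by (intro cop_win.capture[of E _ "mset_set V"] multiset.rel_refl) (auto simp: cmove_def)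
  then have "cops_win V E (card V)"
    using finV unfolding cops_win_def by (intro exI[of _ "mset_set V"]) auto
  then have least: "cops_win V E (attacking_cop_number V E)"
    unfolding attacking_cop_number_def by (rule LeastI)
  have "attacking_cop_number V E = 2 \<longleftrightarrow> cops_win V E 2"
  proof
    assume "cops_win V E 2"
    then have "attacking_cop_number V E \<le> 2" unfolding attacking_cop_number_def by (rule Least_le)
    moreover have "\<not> attacking_cop_number V E \<le> 1" using lose least by blast
    ultimately show "attacking_cop_number V E = 2" by linarith
  qed (use least in simp)
  also have "\<dots> \<longleftrightarrow> (\<forall>C. cyc C \<longrightarrow> card C \<le> 6) \<and>
      (\<forall>C C'. cyc C \<longrightarrow> cyc C' \<longrightarrow> 5 \<le> card C \<longrightarrow> 5 \<le> card C' \<longrightarrow> C = C')"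
    using cops_win_necessary cops_win_sufficient by blast
  finally show ?thesis unfolding faces_condition_iff .
qed

end
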